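(* Let $\{(W_i,\theta_i)\}$ be a standard inverse system and let $V$ be a closed separable subspace of $\varprojlim W_i$. Identify $\varprojlim W_i$ with the dual space of the separable Banach space $\varinjlim W_i^*$ via the isometric isomorphism $C:\varprojlim W_i\to(\varinjlim W_i^* )^*$. Then the pair $(\varprojlim W_i,V)$ has the Asymptotic Norming Property if and only if it has the Determining Property.
   Context: Banach spaces are over the real numbers. A standard inverse system $\{(W_i,\theta_i)\}_{i\ge 1}$ is a sequence of finite dimensional Banach spaces $W_i$ together with linear maps $\theta_i:W_{i+1}\to W_i$ of norm $\le 1$. Its inverse limit $\varprojlim W_i$ is the vector space of all $(w_i)\in\prod_i W_i$ with $\theta_i(w_{i+1})=w_i$ for all $i$ and $\sup_i\|w_i\|<\infty$, equipped with the norm $\|(w_i)\|=\lim_{j\to\infty}\|w_j\|$. The projection $\pi_j:\varprojlim W_i\to W_j$ is $\pi_j((w_i))=w_j$. A standard direct system $\{(E_i,\iota_i)\}_{i\ge1}$ is a sequence of finite dimensional Banach spaces $E_i$ and $1$-Lipschitz linear maps $\iota_i:E_i\to E_{i+1}$. Its direct limit $\varinjlim E_i$ is the Banach space obtained as follows: take $\bigsqcup_i E_i$ modulo the equivalence relation identifying $e\in E_i$ and $e'\in E_{i'}$ if their images in $E_j$ coincide for some $j\ge\max\{i,i'\}$; this is a vector space with pseudo-norm equal to the limit as $j\to\infty$ of the norms of the images in $E_j$; divide by the subspace of elements of zero pseudo-norm and complete. Let $\tau_i:E_i\to\varinjlim E_i$ denote the canonical maps. The dual of a standard inverse system $\{(W_i,\theta_i)\}$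 is the standard direct system $\{(W_i^*,\theta_i^* )\}$, and $C:\varprojlim W_i\to(\varinjlim W_i^* )^*$ is the isometric isomorphism determined by $C((x_i))(\tau_j(\phi))=\phi(x_j)$ for $\phi\in W_j^*$. For a subspace $V\subset\varprojlim W_i$, the pair $(\varprojlim W_i,V)$ has the Determining Property if every sequence $\{v_k\}\subset V$ satisfying the following three conditions converges strongly (i.e. in norm): (a) for every $j$ the sequence $\{\pi_j(v_k)\}_k$ converges in $W_j$; (b) $\{\|v_k\|\}$ is bounded; (c) the convergence $\|\pi_j(v_k)\|\to\|v_k\|$ as $j\to\infty$ is uniform in $k$. For a separable Banach space $Y$ and a separable subspace $V\subset Y^*$, the pair $(Y^*,V)$ has the Asymptotic Norming Property (ANP) if a sequence $\{v_k\}\subset V$ converges strongly (i.e. in norm) whenever it is weak* convergent in $Y^*$ and the sequence of norms $\{\|v_k\|\}$ converges to the norm of the weak* limit. *)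

theory Defs
  imports "HOL-Analysis.Analysis"
begin

text \<open>
  The members of a standard system are different spaces for different indices, and the direct
  limit depends on the whole system. All spaces are therefore explicit structures on a carrier
  rather than types. Operations and norms are meaningful on the carrier only.
  Sequences are indexed from 0 instead of 1.
\<close>

record 'a vstruct =
  carrier :: "'a set"
  vzero :: 'a
  vadd :: "'a \<Rightarrow> 'a \<Rightarrow> 'a"
  vscale :: "real \<Rightarrow> 'a \<Rightarrow> 'a"
  vnorm :: "'a \<Rightarrow> real"

locale normed_space =
  fixes X :: "'a vstruct"
  assumes zero_closed: "vzero X \<in> carrier X"
    and add_closed: "\<lbrakk>x \<in> carrier X; y \<in> carrier X\<rbrakk> \<Longrightarrow> vadd X x y \<in> carrier X"
    and scale_closed: "x \<in> carrier X \<Longrightarrow> vscale X c x \<in> carrier X"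
    and add_assoc: "\<lbrakk>x \<in> carrier X; y \<in> carrier X; z \<in> carrier X\<rbrakk>
      \<Longrightarrow> vadd X (vadd X x y) z = vadd X x (vadd X y z)"
    and add_commute: "\<lbrakk>x \<in> carrier X; y \<in> carrier X\<rbrakk> \<Longrightarrow> vadd X x y = vadd X y x"
    and add_zero: "x \<in> carrier X \<Longrightarrow> vadd X (vzero X) x = x"
    and add_inverse: "x \<in> carrier X \<Longrightarrow> \<exists>y\<in>carrier X. vadd X x y = vzero X"
    and scale_add_right: "\<lbrakk>x \<in> carrier X; y \<in> carrier X\<rbrakk>
      \<Longrightarrow> vscale X c (vadd X x y) = vadd X (vscale X c x) (vscale X c y)"
    and scale_add_left: "x \<in> carrier X
      \<Longrightarrow> vscale X (c + d) x = vadd X (vscale X c x) (vscale X d x)"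
    and scale_scale: "x \<in> carrier X \<Longrightarrow> vscale X c (vscale X d x) = vscale X (c * d) x"
    and scale_one: "x \<in> carrier X \<Longrightarrow> vscale X 1 x = x"
    and norm_nonneg: "x \<in> carrier X \<Longrightarrow> 0 \<le> vnorm X x"
    and norm_eq_zero: "x \<in> carrier X \<Longrightarrow> vnorm X x = 0 \<longleftrightarrow> x = vzero X"
    and norm_triangle: "\<lbrakk>x \<in> carrier X; y \<in> carrier X\<rbrakk>
      \<Longrightarrow> vnorm X (vadd X x y) \<le> vnorm X x + vnorm X y"
    and norm_scale: "x \<in> carrier X \<Longrightarrow> vnorm X (vscale X c x) = \<bar>c\<bar> * vnorm X x"

definition vminus :: "'a vstruct \<Rightarrow> 'a \<Rightarrow> 'a \<Rightarrow> 'a" where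
  "vminus X x y = vadd X x (vscale X (-1) y)"

text \<open>
  The value 0 outside the carrier is needed because \<^locale>\<open>Metric_space\<close> asks for
  nonnegativity and symmetry of the distance on the whole type.
\<close>

definition vdist :: "'a vstruct \<Rightarrow> 'a \<Rightarrow> 'a \<Rightarrow> real" where
  "vdist X x y = (if x \<in> carrier X \<and> y \<in> carrier X then vnorm X (vminus X x y) else 0)"

definition norm_topology :: "'a vstruct \<Rightarrow> 'a topology" where
  "norm_topology X = Metric_space.mtopology (carrier X) (vdist X)"

definition banach_space :: "'a vstruct \<Rightarrow> bool" where
  "banach_space X \<longleftrightarrow> normed_space X \<and> Metric_space.mcomplete (carrier X) (vdist X)"

definition vsubspace :: "'a vstruct \<Rightarrow> 'a set \<Rightarrow> bool" where
  "vsubspace X S \<longleftrightarrow> S \<subseteq> carrier X \<and> vzero X \<in> S \<and>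
     (\<forall>x\<in>S. \<forall>y\<in>S. vadd X x y \<in> S) \<and> (\<forall>c. \<forall>x\<in>S. vscale X c x \<in> S)"

definition finite_dimensional :: "'a vstruct \<Rightarrow> bool" where
  "finite_dimensional X \<longleftrightarrow>
     (\<exists>B. finite B \<and> B \<subseteq> carrier X \<and> vsubspace X hull B = carrier X)"

definition vlinear :: "'a vstruct \<Rightarrow> 'b vstruct \<Rightarrow> ('a \<Rightarrow> 'b) \<Rightarrow> bool" where
  "vlinear X Y f \<longleftrightarrow> f \<in> carrier X \<rightarrow> carrier Y \<and>
     (\<forall>x\<in>carrier X. \<forall>y\<in>carrier X. f (vadd X x y) = vadd Y (f x) (f y)) \<and>
     (\<forall>c. \<forall>x\<in>carrier X. f (vscale X c x) = vscale Y c (f x))"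

definition real_line :: "real vstruct" where
  "real_line = \<lparr>carrier = UNIV, vzero = 0, vadd = (+), vscale = (*), vnorm = abs\<rparr>"

text \<open>Functionals are \<^const>\<open>extensional\<close>, so that they are determined by their values on the carrier.\<close>

definition dual_space :: "'a vstruct \<Rightarrow> ('a \<Rightarrow> real) vstruct" where
  "dual_space X =
     \<lparr>carrier = {f \<in> extensional (carrier X). vlinear X real_line f \<and>
                  (\<exists>K. \<forall>x\<in>carrier X. \<bar>f x\<bar> \<le> K * vnorm X x)},
      vzero = (\<lambda>x\<in>carrier X. 0),
      vadd = (\<lambda>f g. \<lambda>x\<in>carrier X. f x + g x),
      vscale = (\<lambda>c f. \<lambda>x\<in>carrier X. c * f x),
      vnorm = (\<lambda>f. SUP x\<in>{x \<in> carrier X. vnorm X x \<le> 1}. \<bar>f x\<bar>)\<rparr>"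

definition dual_map :: "'a vstruct \<Rightarrow> ('a \<Rightarrow> 'b) \<Rightarrow> ('b \<Rightarrow> real) \<Rightarrow> ('a \<Rightarrow> real)" where
  "dual_map X f \<phi> = (\<lambda>x\<in>carrier X. \<phi> (f x))"


definition standard_inverse_system ::
    "(nat \<Rightarrow> 'a vstruct) \<Rightarrow> (nat \<Rightarrow> 'a \<Rightarrow> 'a) \<Rightarrow> bool" where
  "standard_inverse_system W \<theta> \<longleftrightarrow>
     (\<forall>i. banach_space (W i) \<and> finite_dimensional (W i)) \<and>
     (\<forall>i. vlinear (W (Suc i)) (W i) (\<theta> i) \<and>
          (\<forall>x\<in>carrier (W (Suc i)). vnorm (W i) (\<theta> i x) \<le> vnorm (W (Suc i)) x))"

definition inverse_limit ::
    "(nat \<Rightarrow> 'a vstruct) \<Rightarrow> (nat \<Rightarrow> 'a \<Rightarrow> 'a) \<Rightarrow> (nat \<Rightarrow> 'a) vstruct" where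
  "inverse_limit W \<theta> =
     \<lparr>carrier = {w. (\<forall>i. w i \<in> carrier (W i) \<and> \<theta> i (w (Suc i)) = w i) \<and>
                   bdd_above (range (\<lambda>i. vnorm (W i) (w i)))},
      vzero = (\<lambda>i. vzero (W i)),
      vadd = (\<lambda>v w i. vadd (W i) (v i) (w i)),
      vscale = (\<lambda>c w i. vscale (W i) c (w i)),
      vnorm = (\<lambda>w. lim (\<lambda>j. vnorm (W j) (w j)))\<rparr>"

definition proj :: "nat \<Rightarrow> (nat \<Rightarrow> 'a) \<Rightarrow> 'a" where
  "proj j w = w j"


text \<open>
  Quotient by a relation compatible with the structure. Representatives are used as in
  \<^theory>\<open>HOL.Equiv_Relations\<close>; the norm of a class is the common value on its members.
\<close>

definition quotient_structure :: "'a vstruct \<Rightarrow> ('a \<times> 'a) set \<Rightarrow> 'a set vstruct" where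
  "quotient_structure X R =
     \<lparr>carrier = carrier X // R,
      vzero = R `` {vzero X},
      vadd = (\<lambda>A B. \<Union>x\<in>A. \<Union>y\<in>B. R `` {vadd X x y}),
      vscale = (\<lambda>c A. \<Union>x\<in>A. R `` {vscale X c x}),
      vnorm = (\<lambda>A. the_elem (vnorm X ` A))\<rparr>"

definition null_rel :: "'a vstruct \<Rightarrow> ('a \<times> 'a) set" where
  "null_rel X = {(x, y). x \<in> carrier X \<and> y \<in> carrier X \<and> vnorm X (vminus X x y) = 0}"

definition separated_quotient :: "'a vstruct \<Rightarrow> 'a set vstruct" where
  "separated_quotient X = quotient_structure X (null_rel X)"

definition cauchy_sequences :: "'a vstruct \<Rightarrow> (nat \<Rightarrow> 'a) vstruct" where
  "cauchy_sequences X =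
     \<lparr>carrier = {s. Metric_space.MCauchy (carrier X) (vdist X) s},
      vzero = (\<lambda>n. vzero X),
      vadd = (\<lambda>s t n. vadd X (s n) (t n)),
      vscale = (\<lambda>c s n. vscale X c (s n)),
      vnorm = (\<lambda>s. lim (\<lambda>n. vnorm X (s n)))\<rparr>"

definition norm_completion :: "'a vstruct \<Rightarrow> (nat \<Rightarrow> 'a) set vstruct" where
  "norm_completion X = separated_quotient (cauchy_sequences X)"

text \<open>For \<open>i \<le> j\<close>, the composite map from \<open>E i\<close> to \<open>E j\<close> of a direct system.\<close>

definition bond :: "(nat \<Rightarrow> 'a \<Rightarrow> 'a) \<Rightarrow> nat \<Rightarrow> nat \<Rightarrow> 'a \<Rightarrow> 'a" where
  "bond \<iota> i j = fold \<iota> [i..<j]"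

text \<open>
  The disjoint union of the spaces of a direct system. Elements of different spaces are added
  in the later of the two.
\<close>

definition disjoint_union ::
    "(nat \<Rightarrow> 'a vstruct) \<Rightarrow> (nat \<Rightarrow> 'a \<Rightarrow> 'a) \<Rightarrow> (nat \<times> 'a) vstruct" where
  "disjoint_union E \<iota> =
     \<lparr>carrier = (SIGMA i:UNIV. carrier (E i)),
      vzero = (0, vzero (E 0)),
      vadd = (\<lambda>(i, x) (j, y).
        let k = max i j in (k, vadd (E k) (bond \<iota> i k x) (bond \<iota> j k y))),
      vscale = (\<lambda>c (i, x). (i, vscale (E i) c x)),
      vnorm = (\<lambda>(i, x). lim (\<lambda>j. vnorm (E j) (bond \<iota> i j x)))\<rparr>"

definition germ_rel ::
    "(nat \<Rightarrow> 'a vstruct) \<Rightarrow> (nat \<Rightarrow> 'a \<Rightarrow> 'a) \<Rightarrow> ((nat \<times> 'a) \<times> (nat \<times> 'a)) set" where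
  "germ_rel E \<iota> = {((i, x), (i', x')). x \<in> carrier (E i) \<and> x' \<in> carrier (E i') \<and>
     (\<exists>j\<ge>max i i'. bond \<iota> i j x = bond \<iota> i' j x')}"

definition algebraic_limit ::
    "(nat \<Rightarrow> 'a vstruct) \<Rightarrow> (nat \<Rightarrow> 'a \<Rightarrow> 'a) \<Rightarrow> (nat \<times> 'a) set vstruct" where
  "algebraic_limit E \<iota> = quotient_structure (disjoint_union E \<iota>) (germ_rel E \<iota>)"

definition direct_limit ::
    "(nat \<Rightarrow> 'a vstruct) \<Rightarrow> (nat \<Rightarrow> 'a \<Rightarrow> 'a) \<Rightarrow> (nat \<Rightarrow> (nat \<times> 'a) set set) set vstruct" where
  "direct_limit E \<iota> = norm_completion (separated_quotient (algebraic_limit E \<iota>))"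

text \<open>The class of \<open>(i, x)\<close>, then its class modulo null elements, then the constant sequence.\<close>

definition canonical_map ::
    "(nat \<Rightarrow> 'a vstruct) \<Rightarrow> (nat \<Rightarrow> 'a \<Rightarrow> 'a) \<Rightarrow> nat \<Rightarrow> 'a \<Rightarrow> (nat \<Rightarrow> (nat \<times> 'a) set set) set" where
  "canonical_map E \<iota> i x =
     null_rel (cauchy_sequences (separated_quotient (algebraic_limit E \<iota>))) ``
       {\<lambda>n. null_rel (algebraic_limit E \<iota>) `` {germ_rel E \<iota> `` {(i, x)}}}"


abbreviation dual_spaces :: "(nat \<Rightarrow> 'a vstruct) \<Rightarrow> nat \<Rightarrow> ('a \<Rightarrow> real) vstruct" where
  "dual_spaces W \<equiv> (\<lambda>i. dual_space (W i))"

abbreviation dual_maps ::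
    "(nat \<Rightarrow> 'a vstruct) \<Rightarrow> (nat \<Rightarrow> 'a \<Rightarrow> 'a) \<Rightarrow> nat \<Rightarrow> ('a \<Rightarrow> real) \<Rightarrow> ('a \<Rightarrow> real)" where
  "dual_maps W \<theta> \<equiv> (\<lambda>i. dual_map (W (Suc i)) (\<theta> i))"

definition predual ::
    "(nat \<Rightarrow> 'a vstruct) \<Rightarrow> (nat \<Rightarrow> 'a \<Rightarrow> 'a) \<Rightarrow> (nat \<Rightarrow> (nat \<times> ('a \<Rightarrow> real)) set set) set vstruct" where
  "predual W \<theta> = direct_limit (dual_spaces W) (dual_maps W \<theta>)"

text \<open>
  The isometric isomorphism from the inverse limit onto the dual of the predual. The functional
  is unique because the images of the canonical maps are dense.
\<close>

definition dual_iso ::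
    "(nat \<Rightarrow> 'a vstruct) \<Rightarrow> (nat \<Rightarrow> 'a \<Rightarrow> 'a) \<Rightarrow> (nat \<Rightarrow> 'a) \<Rightarrow>
      ((nat \<Rightarrow> (nat \<times> ('a \<Rightarrow> real)) set set) set \<Rightarrow> real)" where
  "dual_iso W \<theta> x = (THE f. f \<in> carrier (dual_space (predual W \<theta>)) \<and>
     (\<forall>j. \<forall>\<phi>\<in>carrier (dual_space (W j)).
        f (canonical_map (dual_spaces W) (dual_maps W \<theta>) j \<phi>) = \<phi> (x j)))"


definition strongly_convergent :: "'a vstruct \<Rightarrow> (nat \<Rightarrow> 'a) \<Rightarrow> bool" where
  "strongly_convergent X v \<longleftrightarrow> (\<exists>l. limitin (norm_topology X) v l sequentially)"

definition determining_property ::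
    "(nat \<Rightarrow> 'a vstruct) \<Rightarrow> (nat \<Rightarrow> 'a \<Rightarrow> 'a) \<Rightarrow> (nat \<Rightarrow> 'a) set \<Rightarrow> bool" where
  "determining_property W \<theta> V \<longleftrightarrow>
     (\<forall>v. range v \<subseteq> V \<and>
        (\<forall>j. strongly_convergent (W j) (\<lambda>k. proj j (v k))) \<and>
        bounded (range (\<lambda>k. vnorm (inverse_limit W \<theta>) (v k))) \<and>
        uniform_limit UNIV (\<lambda>j k. vnorm (W j) (proj j (v k)))
          (\<lambda>k. vnorm (inverse_limit W \<theta>) (v k)) sequentially
        \<longrightarrow> strongly_convergent (inverse_limit W \<theta>) v)"

definition weak_star_limit ::
    "'y vstruct \<Rightarrow> (nat \<Rightarrow> 'y \<Rightarrow> real) \<Rightarrow> ('y \<Rightarrow> real) \<Rightarrow> bool" where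
  "weak_star_limit Y v l \<longleftrightarrow>
     l \<in> carrier (dual_space Y) \<and> (\<forall>y\<in>carrier Y. (\<lambda>k. v k y) \<longlonglongrightarrow> l y)"

text \<open>The property of the pair \<open>(dual_space Y, V)\<close>, for \<open>Y\<close> and \<open>V\<close> separable.\<close>

definition asymptotic_norming_property :: "'y vstruct \<Rightarrow> ('y \<Rightarrow> real) set \<Rightarrow> bool" where
  "asymptotic_norming_property Y V \<longleftrightarrow>
     (\<forall>v l. range v \<subseteq> V \<and> weak_star_limit Y v l \<and>
        (\<lambda>k. vnorm (dual_space Y) (v k)) \<longlonglongrightarrow> vnorm (dual_space Y) l
        \<longrightarrow> strongly_convergent (dual_space Y) v)"

end

theory Submission
  imports Defs
begin

text \<open>
  Write \<open>L\<close> for the inverse limit of the \<open>W j\<close>, \<open>Y\<close> for the direct limit of their duals, and \<open>w j\<close>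
  for the coordinates of \<open>w \<in> L\<close>. The stage norms \<open>\<parallel>w j\<parallel>\<close> increase to \<open>\<parallel>w\<parallel>\<close>, because the maps of the
  system are contractive. Both properties say that certain sequences \<open>v k\<close> of \<open>V\<close> converge in
  norm, and once \<open>L\<close> is known to be the dual of \<open>Y\<close> they concern the same sequences.

  Weak* convergence of \<open>v k\<close> to \<open>w\<close> amounts to boundedness together with \<open>v k j \<longlonglongrightarrow> w j\<close> for every \<open>j\<close>:
  the images of the \<open>W j\<^sup>*\<close> are dense in \<open>Y\<close>, and in the finite-dimensional \<open>W j\<close> weak and norm
  convergence agree (\<open>weak_star_limitI\<close>, \<open>weak_star_limitD\<close>). Boundedness is one of the conditions of
  the Determining Property, and it follows from the convergence of norms in the Asymptotic Norming
  Property. Granted stagewise convergence, \<open>\<parallel>v k\<parallel> \<longlonglongrightarrow> \<parallel>w\<parallel>\<close> is equivalent to uniformity in \<open>k\<close> of \<open>\<parallel>v k j\<parallel> \<longlonglongrightarrow> \<parallel>v k\<parallel>\<close>.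
  Uniformity permits exchanging the limits over \<open>k\<close> and \<open>j\<close>; conversely, the convergence over \<open>j\<close>
  is monotone, and a Dini-type argument applies (\<open>uniform_limit_of_monotone\<close>). Finally, bounded
  stagewise limits stay in \<open>L\<close> (\<open>stagewise_limit\<close>), which provides the weak* limit when it is
  not given in advance.

  Most of the work goes into the duality. The direct limit is a completion of a quotient of a
  quotient of a disjoint union, but only four facts about it are used: it is a normed space, the
  canonical maps are linear and compatible with the system, the norm of an image is the limit of
  the norms along the system, and the images are dense. Each \<open>x \<in> L\<close> prescribes the value
  \<open>\<phi> (x j)\<close> at the image of \<open>\<phi>\<close>. This is a linear relation bounded by \<open>\<parallel>x\<parallel>\<close>, which the
  Hahn-Banach theorem turns into a functional on \<open>Y\<close>. The functional is unique by density, and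
  its norm is \<open>\<parallel>x\<parallel>\<close> because the \<open>W j\<close> have norming functionals. Surjectivity is reflexivity of the
  \<open>W j\<close> (\<open>dual_iso_surj\<close>).
\<close>

section \<open>Seminormed spaces\<close>

text \<open>
  The intermediate stages of the direct limit (the space of germs, the space of Cauchy sequences)
  carry only a pseudo-norm, so vector algebra is developed without definiteness of the norm.
\<close>

locale seminormed_space =
  fixes X :: "'a vstruct"
  assumes zero_closed: "vzero X \<in> carrier X"
    and add_closed: "\<lbrakk>x \<in> carrier X; y \<in> carrier X\<rbrakk> \<Longrightarrow> vadd X x y \<in> carrier X"
    and scale_closed: "x \<in> carrier X \<Longrightarrow> vscale X c x \<in> carrier X"
    and add_assoc: "\<lbrakk>x \<in> carrier X; y \<in> carrier X; z \<in> carrier X\<rbrakk>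
      \<Longrightarrow> vadd X (vadd X x y) z = vadd X x (vadd X y z)"
    and add_commute: "\<lbrakk>x \<in> carrier X; y \<in> carrier X\<rbrakk> \<Longrightarrow> vadd X x y = vadd X y x"
    and add_zero: "x \<in> carrier X \<Longrightarrow> vadd X (vzero X) x = x"
    and add_inverse: "x \<in> carrier X \<Longrightarrow> \<exists>y\<in>carrier X. vadd X x y = vzero X"
    and scale_add_right: "\<lbrakk>x \<in> carrier X; y \<in> carrier X\<rbrakk>
      \<Longrightarrow> vscale X c (vadd X x y) = vadd X (vscale X c x) (vscale X c y)"
    and scale_add_left: "x \<in> carrier X
      \<Longrightarrow> vscale X (c + d) x = vadd X (vscale X c x) (vscale X d x)"
    and scale_scale: "x \<in> carrier X \<Longrightarrow> vscale X c (vscale X d x) = vscale X (c * d) x"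
    and scale_one: "x \<in> carrier X \<Longrightarrow> vscale X 1 x = x"
    and norm_nonneg: "x \<in> carrier X \<Longrightarrow> 0 \<le> vnorm X x"
    and norm_triangle: "\<lbrakk>x \<in> carrier X; y \<in> carrier X\<rbrakk>
      \<Longrightarrow> vnorm X (vadd X x y) \<le> vnorm X x + vnorm X y"
    and norm_scale: "x \<in> carrier X \<Longrightarrow> vnorm X (vscale X c x) = \<bar>c\<bar> * vnorm X x"
begin

lemmas closed = zero_closed add_closed scale_closed

lemma add_left_commute:
  assumes "x \<in> carrier X" "y \<in> carrier X" "z \<in> carrier X"
  shows "vadd X x (vadd X y z) = vadd X y (vadd X x z)"
  using assms add_assoc[of x y z] add_assoc[of y x z] add_commute[of x y] by simp

lemmas add_ac = add_assoc add_commute add_left_commute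

lemma add_zero_right: "x \<in> carrier X \<Longrightarrow> vadd X x (vzero X) = x"
  using add_commute[of x "vzero X"] add_zero zero_closed by simp

lemma scale_zero_left: assumes "x \<in> carrier X" shows "vscale X 0 x = vzero X"
proof -
  have idem: "vadd X (vscale X 0 x) (vscale X 0 x) = vscale X 0 x"
    using scale_add_left[OF assms, of 0 0] by simp
  obtain y where y: "y \<in> carrier X" "vadd X (vscale X 0 x) y = vzero X"
    using add_inverse scale_closed assms by blast
  have "vadd X (vscale X 0 x) (vadd X (vscale X 0 x) y) = vadd X (vscale X 0 x) y"
    using add_assoc[of "vscale X 0 x" "vscale X 0 x" y] y idem assms scale_closed by simp
  then show ?thesis
    using y assms by (simp add: add_zero_right scale_closed)
qed

lemma norm_zero: "vnorm X (vzero X) = 0"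
  using norm_scale[of "vzero X" 0] scale_zero_left zero_closed by simp

lemma scale_zero_right: "vscale X c (vzero X) = vzero X"
  using scale_scale[of "vzero X" c 0] zero_closed by (simp add: scale_zero_left)

lemma add_negative: "x \<in> carrier X \<Longrightarrow> vadd X x (vscale X (-1) x) = vzero X"
  using scale_add_left[of x 1 "-1"] by (simp add: scale_one scale_zero_left)

lemma negative_add: "x \<in> carrier X \<Longrightarrow> vadd X (vscale X (-1) x) x = vzero X"
  using add_negative[of x] by (simp add: add_commute scale_closed)

lemma add_negative_cancel:
  "\<lbrakk>x \<in> carrier X; y \<in> carrier X\<rbrakk> \<Longrightarrow> vadd X x (vadd X (vscale X (-1) x) y) = y"
  by (simp add: add_assoc[symmetric] closed add_negative add_zero)

lemma negative_add_cancel: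
  "\<lbrakk>x \<in> carrier X; y \<in> carrier X\<rbrakk> \<Longrightarrow> vadd X (vscale X (-1) x) (vadd X x y) = y"
  by (simp add: add_assoc[symmetric] closed negative_add add_zero)

lemmas vector_simps = closed vminus_def scale_add_right scale_scale scale_one add_ac
  add_negative negative_add add_negative_cancel negative_add_cancel
  add_zero add_zero_right scale_zero_left scale_zero_right

lemma minus_closed: "\<lbrakk>x \<in> carrier X; y \<in> carrier X\<rbrakk> \<Longrightarrow> vminus X x y \<in> carrier X"
  by (simp add: vminus_def closed)

lemma minus_self: "x \<in> carrier X \<Longrightarrow> vminus X x x = vzero X"
  by (simp add: vector_simps)

lemma minus_zero: "x \<in> carrier X \<Longrightarrow> vminus X x (vzero X) = x"
  by (simp add: vector_simps)

lemma minus_add_cancel: "\<lbrakk>x \<in> carrier X; y \<in> carrier X\<rbrakk> \<Longrightarrow> vadd X (vminus X x y) y = x"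
  by (simp add: vector_simps)

lemma minus_add_minus:
  "\<lbrakk>x \<in> carrier X; y \<in> carrier X; z \<in> carrier X\<rbrakk>
    \<Longrightarrow> vadd X (vminus X x y) (vminus X y z) = vminus X x z"
  by (simp add: vector_simps)

lemma add_minus_add:
  "\<lbrakk>x \<in> carrier X; y \<in> carrier X; x' \<in> carrier X; y' \<in> carrier X\<rbrakk>
    \<Longrightarrow> vminus X (vadd X x y) (vadd X x' y') = vadd X (vminus X x x') (vminus X y y')"
  by (simp add: vector_simps)

lemma scale_minus:
  "\<lbrakk>x \<in> carrier X; y \<in> carrier X\<rbrakk>
    \<Longrightarrow> vscale X c (vminus X x y) = vminus X (vscale X c x) (vscale X c y)"
  by (simp add: vector_simps)

lemma minus_swap:
  "\<lbrakk>x \<in> carrier X; y \<in> carrier X\<rbrakk> \<Longrightarrow> vscale X (-1) (vminus X x y) = vminus X y x"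
  by (simp add: vector_simps)

lemma norm_minus_commute:
  "\<lbrakk>x \<in> carrier X; y \<in> carrier X\<rbrakk> \<Longrightarrow> vnorm X (vminus X x y) = vnorm X (vminus X y x)"
  using minus_swap[of x y] norm_scale[of "vminus X x y" "-1"] minus_closed by simp

lemma norm_minus_triangle:
  assumes "x \<in> carrier X" "y \<in> carrier X" "z \<in> carrier X"
  shows "vnorm X (vminus X x z) \<le> vnorm X (vminus X x y) + vnorm X (vminus X y z)"
  using assms norm_triangle[of "vminus X x y" "vminus X y z"]
  by (simp add: minus_add_minus minus_closed)

lemma abs_norm_diff_le:
  assumes "x \<in> carrier X" "y \<in> carrier X"
  shows "\<bar>vnorm X x - vnorm X y\<bar> \<le> vnorm X (vminus X x y)"
  using norm_minus_triangle[of x y "vzero X"] norm_minus_triangle[of y x "vzero X"]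
    norm_minus_commute[of x y] assms
  by (simp add: minus_zero zero_closed)

end

lemma normed_space_imp_seminormed: "normed_space X \<Longrightarrow> seminormed_space X"
  unfolding normed_space_def seminormed_space_def by (elim conjE, intro conjI; assumption)

sublocale normed_space \<subseteq> seminormed_space
  by (rule normed_space_imp_seminormed) (rule normed_space_axioms)

lemma normed_spaceI:
  assumes "seminormed_space X"
    and definite: "\<And>x. x \<in> carrier X \<Longrightarrow> vnorm X x = 0 \<longleftrightarrow> x = vzero X"
  shows "normed_space X"
proof -
  interpret seminormed_space X by fact
  show ?thesis
    by unfold_locales (fact zero_closed add_closed scale_closed add_assoc add_commute add_zero
      add_inverse scale_add_right scale_add_left scale_scale scale_one norm_nonneg definite
      norm_triangle norm_scale)+
qed

context normed_space
begin

lemma norm_minus_eq_zero: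
  assumes "x \<in> carrier X" "y \<in> carrier X"
  shows "vnorm X (vminus X x y) = 0 \<longleftrightarrow> x = y"
proof
  assume "vnorm X (vminus X x y) = 0"
  then have "vminus X x y = vzero X"
    using norm_eq_zero minus_closed assms by blast
  then show "x = y"
    using minus_add_cancel[OF assms] assms add_zero by metis
qed (simp add: assms minus_self norm_zero)

lemma Metric_space_vdist: "Metric_space (carrier X) (vdist X)"
proof
  show "vdist X x z \<le> vdist X x y + vdist X y z"
    if "x \<in> carrier X" "y \<in> carrier X" "z \<in> carrier X" for x y z
    using that by (simp add: vdist_def norm_minus_triangle)
qed (auto simp: vdist_def norm_minus_commute norm_nonneg minus_closed norm_minus_eq_zero)

lemma limitin_norm_topology_iff:
  assumes "\<And>k. v k \<in> carrier X"
  shows "limitin (norm_topology X) v l sequentially \<longleftrightarrow>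
    l \<in> carrier X \<and> (\<lambda>k. vnorm X (vminus X (v k) l)) \<longlonglongrightarrow> 0"
proof -
  have "l \<in> carrier X \<Longrightarrow> dist (vnorm X (vminus X (v k) l)) 0 = vdist X (v k) l" for k
    using assms[of k] norm_nonneg[OF minus_closed] by (simp add: vdist_def)
  then show ?thesis
    unfolding norm_topology_def Metric_space.limitin_metric[OF Metric_space_vdist] tendsto_iff
    using assms by auto
qed

lemma strongly_convergent_iff:
  assumes "\<And>k. v k \<in> carrier X"
  shows "strongly_convergent X v \<longleftrightarrow>
    (\<exists>l\<in>carrier X. (\<lambda>k. vnorm X (vminus X (v k) l)) \<longlonglongrightarrow> 0)"
  unfolding strongly_convergent_def using limitin_norm_topology_iff[of v, OF assms] by blast

end


section \<open>Linear maps and dual spaces\<close>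

lemma vlinear_closed: "\<lbrakk>vlinear X Y f; x \<in> carrier X\<rbrakk> \<Longrightarrow> f x \<in> carrier Y"
  by (auto simp: vlinear_def)

lemma vlinear_add:
  "\<lbrakk>vlinear X Y f; x \<in> carrier X; y \<in> carrier X\<rbrakk> \<Longrightarrow> f (vadd X x y) = vadd Y (f x) (f y)"
  by (auto simp: vlinear_def)

lemma vlinear_scale:
  "\<lbrakk>vlinear X Y f; x \<in> carrier X\<rbrakk> \<Longrightarrow> f (vscale X c x) = vscale Y c (f x)"
  by (auto simp: vlinear_def)

lemma vlinear_comp: "\<lbrakk>vlinear X Y f; vlinear Y Z g\<rbrakk> \<Longrightarrow> vlinear X Z (\<lambda>x. g (f x))"
  by (auto simp: vlinear_def Pi_iff)

lemma vlinear_id: "vlinear X X (\<lambda>x. x)"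
  by (auto simp: vlinear_def)

lemma vlinear_minus:
  assumes "seminormed_space X" "vlinear X Y f" "x \<in> carrier X" "y \<in> carrier X"
  shows "f (vminus X x y) = vminus Y (f x) (f y)"
  using assms by (simp add: vminus_def vlinear_add vlinear_scale seminormed_space.scale_closed)

lemma dual_carrier_iff:
  "f \<in> carrier (dual_space X) \<longleftrightarrow> f \<in> extensional (carrier X) \<and>
    (\<forall>x\<in>carrier X. \<forall>y\<in>carrier X. f (vadd X x y) = f x + f y) \<and>
    (\<forall>c. \<forall>x\<in>carrier X. f (vscale X c x) = c * f x) \<and>
    (\<exists>K. \<forall>x\<in>carrier X. \<bar>f x\<bar> \<le> K * vnorm X x)"
  by (simp add: dual_space_def vlinear_def real_line_def)

lemma
  assumes "f \<in> carrier (dual_space X)"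
  shows dual_add: "\<lbrakk>x \<in> carrier X; y \<in> carrier X\<rbrakk> \<Longrightarrow> f (vadd X x y) = f x + f y"
    and dual_scale: "x \<in> carrier X \<Longrightarrow> f (vscale X c x) = c * f x"
    and dual_bound: "\<exists>K. \<forall>x\<in>carrier X. \<bar>f x\<bar> \<le> K * vnorm X x"
    and dual_ext: "f \<in> extensional (carrier X)"
  using assms by (simp_all add: dual_carrier_iff)

lemma
  shows dual_vzero: "vzero (dual_space X) = (\<lambda>x\<in>carrier X. 0)"
    and dual_vadd: "vadd (dual_space X) f g = (\<lambda>x\<in>carrier X. f x + g x)"
    and dual_vscale: "vscale (dual_space X) c f = (\<lambda>x\<in>carrier X. c * f x)"
    and dual_vnorm: "vnorm (dual_space X) f = (SUP x\<in>{x \<in> carrier X. vnorm X x \<le> 1}. \<bar>f x\<bar>)"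
  by (simp_all add: dual_space_def)

context seminormed_space
begin

lemma dual_minus:
  assumes "f \<in> carrier (dual_space X)" "x \<in> carrier X" "y \<in> carrier X"
  shows "f (vminus X x y) = f x - f y"
  using assms by (simp add: vminus_def dual_add dual_scale closed)

lemma dual_zero: assumes "f \<in> carrier (dual_space X)" shows "f (vzero X) = 0"
  using dual_scale[OF assms zero_closed, of 0] by (simp add: scale_zero_left zero_closed)

lemma unit_ball_bdd:
  assumes "f \<in> carrier (dual_space X)"
  shows "bdd_above ((\<lambda>x. \<bar>f x\<bar>) ` {x \<in> carrier X. vnorm X x \<le> 1})"
proof -
  obtain K where K: "\<forall>x\<in>carrier X. \<bar>f x\<bar> \<le> K * vnorm X x"
    using dual_bound[OF assms] by blast
  have "\<bar>f x\<bar> \<le> \<bar>K\<bar>" if "x \<in> carrier X" "vnorm X x \<le> 1" for x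
  proof -
    have "\<bar>f x\<bar> \<le> K * vnorm X x" using K that by blast
    also have "\<dots> \<le> \<bar>K\<bar> * 1"
      using that norm_nonneg[of x] by (intro mult_mono) auto
    finally show ?thesis by simp
  qed
  then show ?thesis by (intro bdd_aboveI[of _ "\<bar>K\<bar>"]) auto
qed

lemma dual_norm_le:
  assumes "0 \<le> K" "\<And>x. x \<in> carrier X \<Longrightarrow> \<bar>f x\<bar> \<le> K * vnorm X x"
  shows "vnorm (dual_space X) f \<le> K"
  unfolding dual_vnorm
proof (rule cSUP_least)
  show "{x \<in> carrier X. vnorm X x \<le> 1} \<noteq> {}"
    using zero_closed norm_zero by auto
  show "\<bar>f x\<bar> \<le> K" if "x \<in> {x \<in> carrier X. vnorm X x \<le> 1}" for x
    using that assms(2)[of x] mult_left_le[of "vnorm X x" K] assms(1) by auto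
qed

lemma dual_norm_nonneg:
  assumes "f \<in> carrier (dual_space X)" shows "0 \<le> vnorm (dual_space X) f"
  unfolding dual_vnorm
  using cSUP_upper[OF _ unit_ball_bdd[OF assms], of "vzero X"] norm_zero zero_closed
  by (simp add: dual_zero[OF assms])

lemma dual_le_norm:
  assumes f: "f \<in> carrier (dual_space X)" and x: "x \<in> carrier X"
  shows "\<bar>f x\<bar> \<le> vnorm (dual_space X) f * vnorm X x"
proof (cases "vnorm X x = 0")
  case True
  then show ?thesis using dual_bound[OF f] x by force
next
  case False
  define r where "r = vnorm X x"
  have r: "r > 0" using False norm_nonneg[OF x] by (simp add: r_def)
  have "vnorm X (vscale X (1 / r) x) \<le> 1"
    using r by (simp add: norm_scale[OF x] r_def)
  then have "\<bar>f (vscale X (1 / r) x)\<bar> \<le> vnorm (dual_space X) f"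
    unfolding dual_vnorm using x by (intro cSUP_upper unit_ball_bdd[OF f]) (auto simp: closed)
  then have "\<bar>f x\<bar> / r \<le> vnorm (dual_space X) f"
    using r by (simp add: dual_scale[OF f x] abs_mult)
  then show ?thesis using r by (simp add: r_def divide_le_eq)
qed

lemma dual_carrierI:
  assumes "f \<in> extensional (carrier X)"
    "\<And>x y. \<lbrakk>x \<in> carrier X; y \<in> carrier X\<rbrakk> \<Longrightarrow> f (vadd X x y) = f x + f y"
    "\<And>c x. x \<in> carrier X \<Longrightarrow> f (vscale X c x) = c * f x"
    "\<And>x. x \<in> carrier X \<Longrightarrow> \<bar>f x\<bar> \<le> K * vnorm X x"
  shows "f \<in> carrier (dual_space X)"
  using assms unfolding dual_carrier_iff by blast

lemma dual_zero_closed: "vzero (dual_space X) \<in> carrier (dual_space X)"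
  by (rule dual_carrierI[where K=0]) (auto simp: dual_vzero closed)

lemma dual_add_closed:
  assumes "f \<in> carrier (dual_space X)" "g \<in> carrier (dual_space X)"
  shows "vadd (dual_space X) f g \<in> carrier (dual_space X)"
proof (rule dual_carrierI[where K="vnorm (dual_space X) f + vnorm (dual_space X) g"])
  show "\<bar>vadd (dual_space X) f g x\<bar> \<le>
      (vnorm (dual_space X) f + vnorm (dual_space X) g) * vnorm X x" if "x \<in> carrier X" for x
    using that dual_le_norm[OF assms(1) that] dual_le_norm[OF assms(2) that]
    by (simp add: dual_vadd distrib_right)
qed (use assms in \<open>auto simp: dual_vadd closed dual_add dual_scale algebra_simps\<close>)

lemma dual_scale_closed:
  assumes "f \<in> carrier (dual_space X)"
  shows "vscale (dual_space X) c f \<in> carrier (dual_space X)"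
proof (rule dual_carrierI[where K="\<bar>c\<bar> * vnorm (dual_space X) f"])
  show "\<bar>vscale (dual_space X) c f x\<bar> \<le> \<bar>c\<bar> * vnorm (dual_space X) f * vnorm X x"
    if "x \<in> carrier X" for x
    using that mult_left_mono[OF dual_le_norm[OF assms that], of "\<bar>c\<bar>"]
    by (simp add: dual_vscale abs_mult mult.assoc)
qed (use assms in \<open>auto simp: dual_vscale closed dual_add dual_scale algebra_simps\<close>)

lemma dual_norm_scale_le:
  assumes f: "f \<in> carrier (dual_space X)"
  shows "vnorm (dual_space X) (vscale (dual_space X) c f) \<le> \<bar>c\<bar> * vnorm (dual_space X) f"
proof (rule dual_norm_le)
  show "\<bar>vscale (dual_space X) c f x\<bar> \<le> \<bar>c\<bar> * vnorm (dual_space X) f * vnorm X x"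
    if "x \<in> carrier X" for x
    using that mult_left_mono[OF dual_le_norm[OF f that], of "\<bar>c\<bar>"]
    by (simp add: dual_vscale abs_mult mult.assoc)
qed (use dual_norm_nonneg[OF f] in simp)

lemma dual_eqI:
  assumes "f \<in> carrier (dual_space X)" "g \<in> carrier (dual_space X)"
    "\<And>x. x \<in> carrier X \<Longrightarrow> f x = g x"
  shows "f = g"
  using assms by (blast intro: extensionalityI dual_ext)

lemma normed_space_dual: "normed_space (dual_space X)"
proof
  let ?D = "dual_space X"
  note [simp] = dual_zero_closed dual_add_closed dual_scale_closed
  note eq = dual_vadd dual_vscale dual_vzero
  show "vadd ?D (vadd ?D f g) h = vadd ?D f (vadd ?D g h)" for f g h
    by (auto simp: eq)
  show "vadd ?D f g = vadd ?D g f" for f g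
    by (auto simp: eq)
  show "vadd ?D (vzero ?D) f = f" if "f \<in> carrier ?D" for f
    using that by (intro extensionalityI[of _ "carrier X"]) (auto simp: eq dual_ext)
  show "\<exists>g\<in>carrier ?D. vadd ?D f g = vzero ?D" if "f \<in> carrier ?D" for f
    by (rule bexI[OF _ dual_scale_closed[OF that, of "-1"]]) (auto simp: eq)
  show "vscale ?D c (vadd ?D f g) = vadd ?D (vscale ?D c f) (vscale ?D c g)" for c f g
    by (auto simp: eq algebra_simps)
  show "vscale ?D (c + d) f = vadd ?D (vscale ?D c f) (vscale ?D d f)" for c d f
    by (auto simp: eq algebra_simps)
  show "vscale ?D c (vscale ?D d f) = vscale ?D (c * d) f" for c d f
    by (auto simp: eq)
  show "vscale ?D 1 f = f" if "f \<in> carrier ?D" for f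
    using that by (intro extensionalityI[of _ "carrier X"]) (auto simp: dual_vscale dual_ext)
  show "vnorm ?D f = 0 \<longleftrightarrow> f = vzero ?D" if f: "f \<in> carrier ?D" for f
  proof
    assume "vnorm ?D f = 0"
    then show "f = vzero ?D"
      using dual_le_norm[OF f] f
      by (intro extensionalityI[of _ "carrier X"]) (auto simp: dual_vzero dual_ext)
  next
    assume "f = vzero ?D"
    then show "vnorm ?D f = 0"
      using dual_norm_le[of 0 f] dual_norm_nonneg[OF f] by (simp add: dual_vzero)
  qed
  show "vnorm ?D (vadd ?D f g) \<le> vnorm ?D f + vnorm ?D g"
    if f: "f \<in> carrier ?D" and g: "g \<in> carrier ?D" for f g
  proof (rule dual_norm_le)
    show "\<bar>vadd ?D f g x\<bar> \<le> (vnorm ?D f + vnorm ?D g) * vnorm X x" if "x \<in> carrier X" for x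
      using that dual_le_norm[OF f that] dual_le_norm[OF g that]
      by (simp add: dual_vadd distrib_right)
  qed (use dual_norm_nonneg f g in simp)
  show "vnorm ?D (vscale ?D c f) = \<bar>c\<bar> * vnorm ?D f" if f: "f \<in> carrier ?D" for c f
  proof (cases "c = 0")
    case True
    then show ?thesis
      using dual_norm_scale_le[OF f, of c] dual_norm_nonneg[OF dual_scale_closed[OF f, of c]]
      by simp
  next
    case False
    \<comment> \<open>Scaling back by \<open>1 / c\<close> turns the upper bound into the lower one.\<close>
    have "vscale ?D (1 / c) (vscale ?D c f) = f"
      using False f by (intro extensionalityI[of _ "carrier X"]) (auto simp: dual_vscale dual_ext)
    then have "vnorm ?D f \<le> \<bar>1 / c\<bar> * vnorm ?D (vscale ?D c f)"
      using dual_norm_scale_le[OF dual_scale_closed[OF f, of c], of "1 / c"] by simp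
    then show ?thesis
      using False dual_norm_scale_le[OF f, of c] by (simp add: field_simps)
  qed
qed (simp_all add: dual_zero_closed dual_add_closed dual_scale_closed dual_norm_nonneg)

end


lemma (in seminormed_space) norm_tendsto:
  assumes "\<And>k. v k \<in> carrier X" "l \<in> carrier X" "(\<lambda>k. vnorm X (vminus X (v k) l)) \<longlonglongrightarrow> 0"
  shows "(\<lambda>k. vnorm X (v k)) \<longlonglongrightarrow> vnorm X l"
proof -
  have "(\<lambda>k. vnorm X (v k) - vnorm X l) \<longlonglongrightarrow> 0"
    by (rule Lim_null_comparison[OF _ assms(3)]) (simp add: abs_norm_diff_le assms)
  then show ?thesis by (simp add: LIM_zero_iff)
qed

lemma (in seminormed_space) dual_tendsto:
  assumes "f \<in> carrier (dual_space X)"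
    and "\<And>k. v k \<in> carrier X" "l \<in> carrier X" "(\<lambda>k. vnorm X (vminus X (v k) l)) \<longlonglongrightarrow> 0"
  shows "(\<lambda>k. f (v k)) \<longlonglongrightarrow> f l"
proof -
  have "norm (f (v k) - f l) \<le> vnorm (dual_space X) f * vnorm X (vminus X (v k) l)" for k
    using dual_le_norm[OF assms(1) minus_closed[OF assms(2)[of k] assms(3)]]
    by (simp add: dual_minus assms)
  moreover have "(\<lambda>k. vnorm (dual_space X) f * vnorm X (vminus X (v k) l)) \<longlonglongrightarrow> 0"
    using tendsto_mult_left[OF assms(4), of "vnorm (dual_space X) f"] by simp
  ultimately have "(\<lambda>k. f (v k) - f l) \<longlonglongrightarrow> 0"
    by (intro Lim_null_comparison[of "\<lambda>k. f (v k) - f l"] always_eventually allI)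
  then show ?thesis by (simp add: LIM_zero_iff)
qed

lemma
  assumes X: "seminormed_space X" and Y: "seminormed_space Y" and f: "vlinear X Y f"
    and contractive: "\<And>x. x \<in> carrier X \<Longrightarrow> vnorm Y (f x) \<le> vnorm X x"
    and \<phi>: "\<phi> \<in> carrier (dual_space Y)"
  shows dual_map_closed: "dual_map X f \<phi> \<in> carrier (dual_space X)"
    and dual_map_contractive: "vnorm (dual_space X) (dual_map X f \<phi>) \<le> vnorm (dual_space Y) \<phi>"
proof -
  interpret X: seminormed_space X by (rule X)
  interpret Y: seminormed_space Y by (rule Y)
  have bound: "\<bar>dual_map X f \<phi> x\<bar> \<le> vnorm (dual_space Y) \<phi> * vnorm X x" if x: "x \<in> carrier X" for x
    using Y.dual_le_norm[OF \<phi> vlinear_closed[OF f x]]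
      mult_left_mono[OF contractive[OF x] Y.dual_norm_nonneg[OF \<phi>]] x
    by (simp add: dual_map_def)
  show "dual_map X f \<phi> \<in> carrier (dual_space X)"
  proof (rule X.dual_carrierI[OF _ _ _ bound])
    show "dual_map X f \<phi> \<in> extensional (carrier X)"
      unfolding dual_map_def by (rule restrict_extensional)
  qed (simp_all add: dual_map_def X.closed vlinear_add[OF f] vlinear_scale[OF f]
      vlinear_closed[OF f] dual_add[OF \<phi>] dual_scale[OF \<phi>])
  show "vnorm (dual_space X) (dual_map X f \<phi>) \<le> vnorm (dual_space Y) \<phi>"
    by (rule X.dual_norm_le[OF Y.dual_norm_nonneg[OF \<phi>] bound])
qed


section \<open>The Hahn-Banach theorem for linear relations\<close>

text \<open>
  A bounded linear relation is the graph of a bounded functional on a subspace: the bound at the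
  zero vector forces it to be single-valued. Graphs are convenient because a union of a chain of
  graphs is a graph, and because a functional prescribed on vectors with many representations
  needs no separate proof that it is well defined.
\<close>

definition bounded_linear_relation :: "'a vstruct \<Rightarrow> real \<Rightarrow> ('a \<times> real) set \<Rightarrow> bool" where
  "bounded_linear_relation X K G \<longleftrightarrow>
     (vzero X, 0) \<in> G \<and>
     (\<forall>(x, r)\<in>G. \<forall>(y, s)\<in>G. (vadd X x y, r + s) \<in> G) \<and>
     (\<forall>c. \<forall>(x, r)\<in>G. (vscale X c x, c * r) \<in> G) \<and>
     (\<forall>(x, r)\<in>G. x \<in> carrier X \<and> \<bar>r\<bar> \<le> K * vnorm X x)"

lemma
  assumes "bounded_linear_relation X K G"
  shows relation_zero: "(vzero X, 0) \<in> G"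
    and relation_add: "\<lbrakk>(x, r) \<in> G; (y, s) \<in> G\<rbrakk> \<Longrightarrow> (vadd X x y, r + s) \<in> G"
    and relation_scale: "(x, r) \<in> G \<Longrightarrow> (vscale X c x, c * r) \<in> G"
    and relation_carrier: "(x, r) \<in> G \<Longrightarrow> x \<in> carrier X"
    and relation_bound: "(x, r) \<in> G \<Longrightarrow> \<bar>r\<bar> \<le> K * vnorm X x"
  using assms unfolding bounded_linear_relation_def by blast+

lemma relation_minus:
  assumes "bounded_linear_relation X K G" "(x, r) \<in> G" "(y, s) \<in> G"
  shows "(vminus X x y, r - s) \<in> G"
  using relation_add[OF assms(1,2) relation_scale[OF assms(1,3), of "-1"]]
  by (simp add: vminus_def)

context seminormed_space
begin

text \<open>
  For any two points of the graph, the triangle inequality through \<open>b\<close> makes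
  the lower bound \<open>r - K * \<parallel>x - b\<parallel>\<close> from one at most the upper bound from the other.
\<close>

lemma hahn_banach_value:
  assumes G: "bounded_linear_relation X K G" and K: "0 \<le> K" and b: "b \<in> carrier X"
  obtains \<rho> where "\<And>x r. (x, r) \<in> G \<Longrightarrow> \<bar>r - \<rho>\<bar> \<le> K * vnorm X (vminus X x b)"
proof -
  define lo where "lo = (\<lambda>(x, r). r - K * vnorm X (vminus X x b))"
  have cross: "r - K * vnorm X (vminus X x b) \<le> s + K * vnorm X (vminus X y b)"
    if "(x, r) \<in> G" "(y, s) \<in> G" for x r y s
  proof -
    have xy: "x \<in> carrier X" "y \<in> carrier X"
      using that relation_carrier[OF G] by auto
    have "r - s \<le> K * vnorm X (vminus X x y)"
      using relation_bound[OF G relation_minus[OF G that]] by simp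
    also have "\<dots> \<le> K * (vnorm X (vminus X x b) + vnorm X (vminus X b y))"
      using xy b K by (intro mult_left_mono norm_minus_triangle)
    finally show ?thesis
      using norm_minus_commute[of b y] b xy by (simp add: algebra_simps)
  qed
  have bdd: "bdd_above (lo ` G)"
    using cross[OF _ relation_zero[OF G]] by (intro bdd_aboveI) (auto simp: lo_def)
  have "\<bar>r - Sup (lo ` G)\<bar> \<le> K * vnorm X (vminus X x b)" if xr: "(x, r) \<in> G" for x r
  proof -
    have "lo (x, r) \<le> Sup (lo ` G)"
      using xr bdd by (intro cSup_upper) auto
    moreover have "Sup (lo ` G) \<le> r + K * vnorm X (vminus X x b)"
      using xr cross[OF _ xr] by (intro cSup_least) (auto simp: lo_def)
    ultimately show ?thesis by (simp add: lo_def abs_le_iff)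
  qed
  then show ?thesis by (rule that)
qed

lemma hahn_banach_step:
  assumes G: "bounded_linear_relation X K G" and K: "0 \<le> K" and b: "b \<in> carrier X"
  shows "\<exists>G'. bounded_linear_relation X K G' \<and> G \<subseteq> G' \<and> b \<in> Domain G'"
proof -
  obtain \<rho> where \<rho>: "\<And>x r. (x, r) \<in> G \<Longrightarrow> \<bar>r - \<rho>\<bar> \<le> K * vnorm X (vminus X x b)"
    using hahn_banach_value[OF assms] by blast
  define G' where "G' = {(vadd X x (vscale X t b), r + t * \<rho>) | x r t. (x, r) \<in> G}"
  have G'I: "(y, s) \<in> G'"
    if "(x, r) \<in> G" "y = vadd X x (vscale X t b)" "s = r + t * \<rho>" for x r t y s
    using that unfolding G'_def by blast
  have sub: "G \<subseteq> G'"
    using relation_carrier[OF G] b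
    by (auto intro!: G'I[where t=0] simp: scale_zero_left add_zero_right)
  have "(b, \<rho>) \<in> G'"
    by (rule G'I[OF relation_zero[OF G], of _ 1]) (simp_all add: b scale_one add_zero)
  moreover have "bounded_linear_relation X K G'"
    unfolding bounded_linear_relation_def
  proof (intro conjI)
    show "(vzero X, 0) \<in> G'" using sub relation_zero[OF G] by blast
    have "(vadd X y y', s + s') \<in> G'" if ys: "(y, s) \<in> G'" "(y', s') \<in> G'" for y s y' s'
    proof -
      obtain x r t x' r' t' where *: "(x, r) \<in> G" "(x', r') \<in> G"
        "y = vadd X x (vscale X t b)" "s = r + t * \<rho>"
        "y' = vadd X x' (vscale X t' b)" "s' = r' + t' * \<rho>"
        using ys unfolding G'_def by blast
      have "x \<in> carrier X" "x' \<in> carrier X" using * relation_carrier[OF G] by auto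
      then show ?thesis
        using * b by (intro G'I[OF relation_add[OF G *(1,2)], of _ "t + t'"])
          (simp_all add: vector_simps scale_add_left algebra_simps)
    qed
    then show "\<forall>(x, r)\<in>G'. \<forall>(y, s)\<in>G'. (vadd X x y, r + s) \<in> G'" by blast
    have "(vscale X c y, c * s) \<in> G'" if ys: "(y, s) \<in> G'" for c y s
    proof -
      obtain x r t where *: "(x, r) \<in> G" "y = vadd X x (vscale X t b)" "s = r + t * \<rho>"
        using ys unfolding G'_def by blast
      have "x \<in> carrier X" using * relation_carrier[OF G] by auto
      then show ?thesis
        using * b by (intro G'I[OF relation_scale[OF G *(1), of c], of _ "c * t"])
          (simp_all add: vector_simps algebra_simps)
    qed
    then show "\<forall>c. \<forall>(x, r)\<in>G'. (vscale X c x, c * r) \<in> G'" by blast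
    have "y \<in> carrier X \<and> \<bar>s\<bar> \<le> K * vnorm X y" if ys: "(y, s) \<in> G'" for y s
    proof -
      obtain x r t where *: "(x, r) \<in> G" "y = vadd X x (vscale X t b)" "s = r + t * \<rho>"
        using ys unfolding G'_def by blast
      have x: "x \<in> carrier X" using * relation_carrier[OF G] by auto
      have "\<bar>s\<bar> \<le> K * vnorm X y"
      proof (cases "t = 0")
        case True
        then show ?thesis
          using * x b relation_bound[OF G *(1)] by (simp add: scale_zero_left add_zero_right)
      next
        case False
        \<comment> \<open>Homogeneity reduces the bound at \<open>x + t b\<close> to the choice of \<open>\<rho>\<close> at \<open>- x / t\<close>.\<close>
        let ?x = "vscale X (- 1 / t) x"
        have y: "y = vscale X (- t) (vminus X ?x b)"
          using False x b by (simp add: *(2) vector_simps)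
        have "\<bar>s\<bar> = \<bar>t\<bar> * \<bar>(- 1 / t) * r - \<rho>\<bar>"
          using False by (simp add: *(3) abs_mult[symmetric] algebra_simps)
        also have "\<dots> \<le> \<bar>t\<bar> * (K * vnorm X (vminus X ?x b))"
          using \<rho>[OF relation_scale[OF G *(1), of "- 1 / t"]] by (intro mult_left_mono) auto
        also have "\<dots> = K * vnorm X y"
          using x b by (simp add: y norm_scale closed minus_closed)
        finally show ?thesis .
      qed
      then show ?thesis using * x b by (simp add: closed)
    qed
    then show "\<forall>(x, r)\<in>G'. x \<in> carrier X \<and> \<bar>r\<bar> \<le> K * vnorm X x" by blast
  qed
  ultimately show ?thesis using sub by blast
qed

theorem hahn_banach:
  assumes G: "bounded_linear_relation X K G" and K: "0 \<le> K"
  obtains f where "f \<in> carrier (dual_space X)" "\<And>x r. (x, r) \<in> G \<Longrightarrow> f x = r"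
    "\<And>x. x \<in> carrier X \<Longrightarrow> \<bar>f x\<bar> \<le> K * vnorm X x"
proof -
  let ?A = "{H. bounded_linear_relation X K H \<and> G \<subseteq> H}"
  have "\<exists>M\<in>?A. \<forall>H\<in>?A. M \<subseteq> H \<longrightarrow> H = M"
  proof (rule subset_Zorn_nonempty)
    show "?A \<noteq> {}" using G by blast
    fix C assume C: "C \<noteq> {}" "subset.chain ?A C"
    then have rel: "H \<in> C \<Longrightarrow> bounded_linear_relation X K H" "H \<in> C \<Longrightarrow> G \<subseteq> H" for H
      by (auto simp: subset_chain_def)
    have two: "\<exists>H\<in>C. p \<in> H \<and> q \<in> H" if pq: "p \<in> \<Union>C" "q \<in> \<Union>C" for p q
    proof -
      obtain A B where AB: "A \<in> C" "B \<in> C" "p \<in> A" "q \<in> B" using pq by blast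
      then have "A \<subseteq> B \<or> B \<subseteq> A" using C(2) by (simp add: subset_chain_def)
      then show ?thesis using AB by blast
    qed
    have "bounded_linear_relation X K (\<Union>C)"
      unfolding bounded_linear_relation_def
    proof (intro conjI)
      show "(vzero X, 0) \<in> \<Union>C" using C(1) relation_zero[OF rel(1)] by blast
      have "(vadd X x y, r + s) \<in> \<Union>C" if rs: "(x, r) \<in> \<Union>C" "(y, s) \<in> \<Union>C" for x r y s
      proof -
        obtain H where "H \<in> C" "(x, r) \<in> H" "(y, s) \<in> H" using two[OF rs] by blast
        then show ?thesis using relation_add[OF rel(1)] by blast
      qed
      then show "\<forall>(x, r)\<in>\<Union>C. \<forall>(y, s)\<in>\<Union>C. (vadd X x y, r + s) \<in> \<Union>C" by blast
      have "(vscale X c x, c * r) \<in> \<Union>C" if "(x, r) \<in> \<Union>C" for c x r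
        using that relation_scale[OF rel(1)] by blast
      then show "\<forall>c. \<forall>(x, r)\<in>\<Union>C. (vscale X c x, c * r) \<in> \<Union>C" by blast
      have "x \<in> carrier X \<and> \<bar>r\<bar> \<le> K * vnorm X x" if "(x, r) \<in> \<Union>C" for x r
        using that relation_carrier[OF rel(1)] relation_bound[OF rel(1)] by blast
      then show "\<forall>(x, r)\<in>\<Union>C. x \<in> carrier X \<and> \<bar>r\<bar> \<le> K * vnorm X x" by blast
    qed
    then show "\<Union>C \<in> ?A" using C(1) rel(2) by blast
  qed
  then obtain M where MA: "M \<in> ?A" and maxA: "\<forall>H\<in>?A. M \<subseteq> H \<longrightarrow> H = M"
    by (elim bexE)
  then have M: "bounded_linear_relation X K M" "G \<subseteq> M" by simp_all
  have single: "r = s" if "(x, r) \<in> M" "(x, s) \<in> M" for x r s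
    using relation_bound[OF M(1) relation_minus[OF M(1) that]] relation_carrier[OF M(1) that(1)]
    by (simp add: minus_self norm_zero)
  have total: "\<exists>r. (x, r) \<in> M" if x: "x \<in> carrier X" for x
  proof -
    obtain H where H: "bounded_linear_relation X K H" "M \<subseteq> H" "x \<in> Domain H"
      using hahn_banach_step[OF M(1) K x] by metis
    then have "H \<in> ?A" using M(2) by simp
    then have "H = M" using maxA H(2) by (metis (no_types, lifting))
    then show ?thesis using H(3) by (simp add: Domain_iff)
  qed
  define f where "f = (\<lambda>x\<in>carrier X. THE r. (x, r) \<in> M)"
  have f: "f x = r" if "(x, r) \<in> M" for x r
    using that single relation_carrier[OF M(1) that] by (auto simp: f_def)
  have fM: "(x, f x) \<in> M" if "x \<in> carrier X" for x
    using total[OF that] f by blast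
  have bound: "\<bar>f x\<bar> \<le> K * vnorm X x" if "x \<in> carrier X" for x
    using relation_bound[OF M(1) fM[OF that]] .
  have "f \<in> carrier (dual_space X)"
  proof (rule dual_carrierI[OF _ _ _ bound])
    show "f \<in> extensional (carrier X)" by (simp add: f_def)
    show "f (vadd X x y) = f x + f y" if "x \<in> carrier X" "y \<in> carrier X" for x y
      using f[OF relation_add[OF M(1) fM fM]] that by blast
    show "f (vscale X c x) = c * f x" if "x \<in> carrier X" for c x
      using f[OF relation_scale[OF M(1) fM]] that by blast
  qed
  then show ?thesis using that f M(2) bound by blast
qed

lemma norming_functional:
  assumes x: "x \<in> carrier X"
  obtains f where "f \<in> carrier (dual_space X)" "f x = vnorm X x" "vnorm (dual_space X) f \<le> 1"
proof -
  let ?G = "{(vscale X t x, t * vnorm X x) | t. True}"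
  have G: "bounded_linear_relation X 1 ?G"
    unfolding bounded_linear_relation_def
  proof (intro conjI)
    show "(vzero X, 0) \<in> ?G"
      using scale_zero_left[OF x] by (auto intro!: exI[of _ 0])
    show "\<forall>(y, r)\<in>?G. \<forall>(z, s)\<in>?G. (vadd X y z, r + s) \<in> ?G"
      using scale_add_left[OF x, symmetric] by (auto simp: distrib_right)
    show "\<forall>c. \<forall>(y, r)\<in>?G. (vscale X c y, c * r) \<in> ?G"
      using scale_scale[OF x] by (auto simp: mult.assoc[symmetric])
    show "\<forall>(y, r)\<in>?G. y \<in> carrier X \<and> \<bar>r\<bar> \<le> 1 * vnorm X y"
      using x norm_nonneg[OF x] by (auto simp: closed norm_scale abs_mult)
  qed
  have xG: "(x, vnorm X x) \<in> ?G"
    using scale_one[OF x] by (auto intro!: exI[of _ 1])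
  show ?thesis
  proof (rule hahn_banach[OF G zero_le_one])
    fix f
    assume f: "f \<in> carrier (dual_space X)" "\<And>y r. (y, r) \<in> ?G \<Longrightarrow> f y = r"
      "\<And>y. y \<in> carrier X \<Longrightarrow> \<bar>f y\<bar> \<le> 1 * vnorm X y"
    show ?thesis
      by (rule that[OF f(1) f(2)[OF xG] dual_norm_le[OF zero_le_one f(3)]])
  qed
qed

end

lemma (in normed_space) dual_separates:
  assumes "x \<in> carrier X" "y \<in> carrier X" "\<And>f. f \<in> carrier (dual_space X) \<Longrightarrow> f x = f y"
  shows "x = y"
proof -
  obtain f where f: "f \<in> carrier (dual_space X)" "f (vminus X x y) = vnorm X (vminus X x y)"
    using norming_functional[OF minus_closed[OF assms(1,2)]] by blast
  then have "vnorm X (vminus X x y) = 0"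
    using assms(3)[OF f(1)] dual_minus[OF f(1) assms(1,2)] by simp
  then show ?thesis using norm_minus_eq_zero assms by blast
qed


section \<open>Finite-dimensional spaces\<close>

text \<open>
  Finite rank operators as an inductive family: finite dimension enters the proof only through
  the fact that the identity is of finite rank, and its two consequences below (reflexivity, and
  weak convergence implying norm convergence) are then rule inductions that need neither bases
  nor finite sums.
\<close>

inductive finite_rank :: "'a vstruct \<Rightarrow> ('a \<Rightarrow> 'a) \<Rightarrow> bool" for X where
  zero: "finite_rank X (\<lambda>x. vzero X)"
| rank_one: "\<lbrakk>finite_rank X P; f \<in> carrier (dual_space X); b \<in> carrier X\<rbrakk>
    \<Longrightarrow> finite_rank X (\<lambda>x. vadd X (vscale X (f x) b) (P x))"

context seminormed_space
begin

lemma finite_rank_vlinear: "finite_rank X P \<Longrightarrow> vlinear X X P"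
proof (induction rule: finite_rank.induct)
  case zero
  then show ?case by (simp add: vlinear_def closed add_zero scale_zero_right)
next
  case (rank_one P f b)
  then have P: "P x \<in> carrier X" if "x \<in> carrier X" for x
    using that by (rule_tac vlinear_closed)
  show ?case
    unfolding vlinear_def
  proof (intro conjI ballI allI)
    show "(\<lambda>x. vadd X (vscale X (f x) b) (P x)) \<in> carrier X \<rightarrow> carrier X"
      using P rank_one by (simp add: closed)
    show "vadd X (vscale X (f (vadd X x y)) b) (P (vadd X x y)) =
        vadd X (vadd X (vscale X (f x) b) (P x)) (vadd X (vscale X (f y) b) (P y))"
      if "x \<in> carrier X" "y \<in> carrier X" for x y
      using P that rank_one by (simp add: vlinear_add dual_add scale_add_left closed add_ac)
    show "vadd X (vscale X (f (vscale X c x)) b) (P (vscale X c x)) =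
        vscale X c (vadd X (vscale X (f x) b) (P x))" if "x \<in> carrier X" for c x
      using P that rank_one
      by (simp add: vlinear_scale dual_scale scale_add_right scale_scale closed)
  qed
qed

text \<open>
  Boundedness of \<open>P\<close> in the form needed below: precomposition with \<open>P\<close> preserves the dual.
\<close>

lemma finite_rank_dual_comp:
  assumes "finite_rank X P" "g \<in> carrier (dual_space X)"
  shows "(\<lambda>x\<in>carrier X. g (P x)) \<in> carrier (dual_space X)"
  using assms(1)
proof (induction rule: finite_rank.induct)
  case zero
  then show ?case
    using dual_zero_closed unfolding dual_zero[OF assms(2)] dual_vzero .
next
  case (rank_one P f b)
  have "P x \<in> carrier X" if "x \<in> carrier X" for x
    using that vlinear_closed[OF finite_rank_vlinear[OF rank_one(1)]] by blast
  then have "(\<lambda>x\<in>carrier X. g (vadd X (vscale X (f x) b) (P x))) =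
      vadd (dual_space X) (vscale (dual_space X) (g b) f) (\<lambda>x\<in>carrier X. g (P x))"
    using rank_one assms(2)
    by (auto simp: dual_vadd dual_vscale dual_add dual_scale closed fun_eq_iff)
  then show ?case
    using rank_one by (simp only: dual_add_closed dual_scale_closed)
qed

text \<open>
  Every functional on the dual agrees with an evaluation after precomposition with a finite rank
  operator: for \<open>f(-) b\<close> the vector is \<open>F(f) b\<close>, and vectors add up.
\<close>

lemma finite_rank_reflexive:
  assumes "finite_rank X P" and F: "vlinear (dual_space X) real_line F"
  shows "\<exists>x\<in>carrier X. \<forall>g\<in>carrier (dual_space X). g x = F (\<lambda>y\<in>carrier X. g (P y))"
  using assms(1)
proof (induction rule: finite_rank.induct)
  case zero
  have "F (\<lambda>x\<in>carrier X. 0) = 0"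
    using vlinear_scale[OF F dual_zero_closed, of 0]
    by (simp add: real_line_def dual_vscale dual_vzero)
  then have "g (vzero X) = F (\<lambda>x\<in>carrier X. g (vzero X))" if "g \<in> carrier (dual_space X)" for g
    unfolding dual_zero[OF that] by (rule sym)
  then show ?case
    using zero_closed by blast
next
  case (rank_one P f b)
  let ?D = "dual_space X"
  obtain x where x: "x \<in> carrier X" "\<And>g. g \<in> carrier ?D \<Longrightarrow> g x = F (\<lambda>y\<in>carrier X. g (P y))"
    using rank_one by blast
  have P: "P x \<in> carrier X" if "x \<in> carrier X" for x
    using that vlinear_closed[OF finite_rank_vlinear[OF rank_one(1)]] by blast
  show ?case
  proof (intro bexI[of _ "vadd X (vscale X (F f) b) x"] ballI)
    fix g assume g: "g \<in> carrier ?D"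
    have eq: "(\<lambda>y\<in>carrier X. g (vadd X (vscale X (f y) b) (P y))) =
        vadd ?D (vscale ?D (g b) f) (\<lambda>y\<in>carrier X. g (P y))"
      using rank_one g P
      by (auto simp: dual_vadd dual_vscale dual_add dual_scale closed fun_eq_iff)
    have "F (\<lambda>y\<in>carrier X. g (vadd X (vscale X (f y) b) (P y))) =
        g b * F f + F (\<lambda>y\<in>carrier X. g (P y))"
      unfolding eq using rank_one g finite_rank_dual_comp[OF rank_one(1) g]
      by (simp add: vlinear_add[OF F] vlinear_scale[OF F] dual_scale_closed real_line_def)
    then show "g (vadd X (vscale X (F f) b) x) =
        F (\<lambda>y\<in>carrier X. g (vadd X (vscale X (f y) b) (P y)))"
      using x rank_one g by (simp add: dual_add dual_scale closed)
  qed (use x rank_one in \<open>simp add: closed\<close>)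
qed

lemma finite_rank_weak_convergence:
  assumes "finite_rank X P" and v: "\<And>k. v k \<in> carrier X"
    and weak: "\<And>f. f \<in> carrier (dual_space X) \<Longrightarrow> convergent (\<lambda>k. f (v k))"
  shows "\<exists>l\<in>carrier X. (\<lambda>k. vnorm X (vminus X (P (v k)) l)) \<longlonglongrightarrow> 0"
  using assms(1)
proof (induction rule: finite_rank.induct)
  case zero
  then show ?case
    by (intro bexI[OF _ zero_closed]) (simp add: minus_self zero_closed norm_zero)
next
  case (rank_one P f b)
  obtain l where l: "l \<in> carrier X" "(\<lambda>k. vnorm X (vminus X (P (v k)) l)) \<longlonglongrightarrow> 0"
    using rank_one by blast
  obtain a where a: "(\<lambda>k. f (v k)) \<longlonglongrightarrow> a"
    using weak[OF rank_one(2)] by (auto simp: convergent_def)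
  have P: "P (v k) \<in> carrier X" for k
    using v vlinear_closed[OF finite_rank_vlinear[OF rank_one(1)]] by blast
  let ?l = "vadd X (vscale X a b) l"
  have bound: "vnorm X (vminus X (vadd X (vscale X (f (v k)) b) (P (v k))) ?l)
      \<le> \<bar>f (v k) - a\<bar> * vnorm X b + vnorm X (vminus X (P (v k)) l)" for k
  proof -
    have "vminus X (vscale X (f (v k)) b) (vscale X a b) = vscale X (f (v k) - a) b"
      using rank_one(3) scale_add_left[of b "f (v k)" "- a"]
      by (simp add: vminus_def scale_scale)
    then have "vminus X (vadd X (vscale X (f (v k)) b) (P (v k))) ?l =
        vadd X (vscale X (f (v k) - a) b) (vminus X (P (v k)) l)"
      using rank_one(3) P l by (simp add: add_minus_add closed)
    then show ?thesis
      using norm_triangle[of "vscale X (f (v k) - a) b" "vminus X (P (v k)) l"] rank_one(3) P l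
      by (simp add: closed minus_closed norm_scale)
  qed
  have "(\<lambda>k. \<bar>f (v k) - a\<bar> * vnorm X b + vnorm X (vminus X (P (v k)) l)) \<longlonglongrightarrow> 0"
    using a l by (auto intro!: tendsto_eq_intros)
  then have "(\<lambda>k. vnorm X (vminus X (vadd X (vscale X (f (v k)) b) (P (v k))) ?l)) \<longlonglongrightarrow> 0"
    by (rule tendsto_sandwich[OF _ _ tendsto_const, rotated 2])
      (use bound rank_one(3) P l in \<open>auto simp: closed minus_closed norm_nonneg\<close>)
  then show ?case using rank_one(3) l by (auto simp: closed)
qed

end

context normed_space
begin

text \<open>
  One vector is added to the fixed space of a projection \<open>P\<close> at a time. If \<open>b\<close> is not
  fixed, its component \<open>c = b - P b\<close> is nonzero, and \<open>g \<circ> (1 - P)\<close>, with \<open>g\<close> a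
  functional taking the value 1 at \<open>c\<close>, vanishes on the fixed space.
\<close>

lemma finite_rank_projection_fixing:
  assumes "finite B" "B \<subseteq> carrier X"
  shows "\<exists>P. finite_rank X P \<and> (\<forall>x\<in>carrier X. P (P x) = P x) \<and> (\<forall>x\<in>B. P x = x)"
  using assms
proof (induction rule: finite_induct)
  case empty
  show ?case by (rule exI[of _ "\<lambda>x. vzero X"]) (simp add: finite_rank.zero)
next
  case (insert b B)
  then obtain P where P: "finite_rank X P" "\<And>x. x \<in> carrier X \<Longrightarrow> P (P x) = P x"
      "\<And>x. x \<in> B \<Longrightarrow> P x = x"
    by auto
  note lin = finite_rank_vlinear[OF P(1)]
  note Pc = vlinear_closed[OF lin]
  have b: "b \<in> carrier X" using insert by simp
  show ?case
  proof (cases "P b = b")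
    case True
    then show ?thesis using P by (intro exI[of _ P]) auto
  next
    case False
    define c where "c = vminus X b (P b)"
    have c: "c \<in> carrier X" using b Pc by (simp add: c_def minus_closed)
    have Pdiff: "P (vminus X x (P x)) = vzero X" if "x \<in> carrier X" for x
      using that Pc P(2) by (simp add: vlinear_minus[OF seminormed_space_axioms lin] minus_self)
    then have Pcz: "P c = vzero X" using b by (simp add: c_def)
    have nc: "vnorm X c \<noteq> 0" using False b Pc by (simp add: c_def norm_minus_eq_zero)
    obtain g0 where g0: "g0 \<in> carrier (dual_space X)" "g0 c = vnorm X c"
      using norming_functional[OF c] by blast
    define g where "g = vscale (dual_space X) (1 / vnorm X c) g0"
    have g: "g \<in> carrier (dual_space X)" "g c = 1"
      using g0 nc c by (simp_all add: g_def dual_scale_closed) (simp add: dual_vscale)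
    define f where "f = vadd (dual_space X) g
      (vscale (dual_space X) (-1) (\<lambda>x\<in>carrier X. g (P x)))"
    have f: "f \<in> carrier (dual_space X)"
      unfolding f_def by (intro dual_add_closed dual_scale_closed finite_rank_dual_comp P(1) g(1))
    have fx: "f x = g x - g (P x)" if "x \<in> carrier X" for x
      using that by (simp add: f_def dual_vadd dual_vscale)
    have fc: "f c = 1" using c g by (simp add: fx Pcz dual_zero)
    have fb: "f b = 1"
      using g dual_minus[OF g(1) b Pc[OF b]] b by (simp add: fx c_def)
    have fP: "f (P x) = 0" if "x \<in> carrier X" for x
      using that P(2) Pc by (simp add: fx)
    let ?P = "\<lambda>x. vadd X (vscale X (f x) c) (P x)"
    have "?P (?P x) = ?P x" if x: "x \<in> carrier X" for x
    proof -
      have "P (?P x) = P x"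
        using x c Pc by (simp add: vlinear_add[OF lin] vlinear_scale[OF lin] P(2) Pcz closed
          scale_zero_right add_zero)
      moreover have "f (?P x) = f x"
        using x c Pc by (simp add: dual_add[OF f] dual_scale[OF f] fc fP closed)
      ultimately show ?thesis by simp
    qed
    moreover have "?P x = x" if x: "x \<in> insert b B" for x
    proof (cases "x = b")
      case True
      then show ?thesis using b Pc by (simp add: fb scale_one c c_def minus_add_cancel minus_closed)
    next
      case False
      then have "x \<in> B" "x \<in> carrier X" using x insert by auto
      then show ?thesis using P(3) fP[of x] c by (simp add: scale_zero_left add_zero)
    qed
    ultimately show ?thesis
      using finite_rank.rank_one[OF P(1) f c] by (intro exI[of _ ?P]) blast
  qed
qed

lemma finite_rank_identity:
  assumes "finite_dimensional X"
  obtains P where "finite_rank X P" "\<And>x. x \<in> carrier X \<Longrightarrow> P x = x"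
proof -
  obtain B where B: "finite B" "B \<subseteq> carrier X" "vsubspace X hull B = carrier X"
    using assms unfolding finite_dimensional_def by blast
  obtain P where P: "finite_rank X P" "\<forall>x\<in>B. P x = x"
    using finite_rank_projection_fixing[OF B(1,2)] by blast
  note lin = finite_rank_vlinear[OF P(1)]
  have "P (vzero X) = vzero X"
    using vlinear_scale[OF lin zero_closed, of 0] vlinear_closed[OF lin zero_closed]
    by (simp add: scale_zero_left zero_closed)
  then have "vsubspace X {x \<in> carrier X. P x = x}"
    unfolding vsubspace_def by (auto simp: closed vlinear_add[OF lin] vlinear_scale[OF lin])
  moreover have "B \<subseteq> {x \<in> carrier X. P x = x}"
    using B P by auto
  ultimately have "carrier X \<subseteq> {x \<in> carrier X. P x = x}"
    using hull_minimal[of B _ "vsubspace X"] B(3) by blast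
  then show ?thesis using that P(1) by blast
qed

lemma finite_dimensional_reflexive:
  assumes "finite_dimensional X" and F: "vlinear (dual_space X) real_line F"
  obtains x where "x \<in> carrier X" "\<And>g. g \<in> carrier (dual_space X) \<Longrightarrow> F g = g x"
proof -
  obtain P where P: "finite_rank X P" "\<And>x. x \<in> carrier X \<Longrightarrow> P x = x"
    using finite_rank_identity[OF assms(1)] by blast
  have "(\<lambda>y\<in>carrier X. g (P y)) = g" if "g \<in> carrier (dual_space X)" for g
    using dual_ext[OF that] P(2) by (auto simp: fun_eq_iff extensional_def)
  then show ?thesis
    using finite_rank_reflexive[OF P(1) F] that by metis
qed

lemma finite_dimensional_weak_convergence:
  assumes "finite_dimensional X" and v: "\<And>k. v k \<in> carrier X"
    and weak: "\<And>f. f \<in> carrier (dual_space X) \<Longrightarrow> convergent (\<lambda>k. f (v k))"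
  shows "\<exists>l\<in>carrier X. (\<lambda>k. vnorm X (vminus X (v k) l)) \<longlonglongrightarrow> 0"
proof -
  obtain P where P: "finite_rank X P" "\<And>x. x \<in> carrier X \<Longrightarrow> P x = x"
    using finite_rank_identity[OF assms(1)] by blast
  show ?thesis
    using finite_rank_weak_convergence[OF P(1), of v, OF v weak] by (simp add: P(2) v)
qed

end


section \<open>Quotients and completions\<close>

text \<open>
  The vector space axioms up to a compatible equivalence. The disjoint union of the spaces of a
  direct system satisfies them only in this weak form, already for associativity of addition.
\<close>

locale seminormed_setoid =
  fixes X :: "'a vstruct" and R :: "('a \<times> 'a) set"
  assumes equiv: "equiv (carrier X) R"
    and zero_closed: "vzero X \<in> carrier X"
    and add_closed: "\<lbrakk>x \<in> carrier X; y \<in> carrier X\<rbrakk> \<Longrightarrow> vadd X x y \<in> carrier X"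
    and scale_closed: "x \<in> carrier X \<Longrightarrow> vscale X c x \<in> carrier X"
    and add_cong: "\<lbrakk>(x, x') \<in> R; (y, y') \<in> R\<rbrakk> \<Longrightarrow> (vadd X x y, vadd X x' y') \<in> R"
    and scale_cong: "(x, x') \<in> R \<Longrightarrow> (vscale X c x, vscale X c x') \<in> R"
    and norm_cong: "(x, x') \<in> R \<Longrightarrow> vnorm X x = vnorm X x'"
    and add_assoc: "\<lbrakk>x \<in> carrier X; y \<in> carrier X; z \<in> carrier X\<rbrakk>
      \<Longrightarrow> (vadd X (vadd X x y) z, vadd X x (vadd X y z)) \<in> R"
    and add_commute: "\<lbrakk>x \<in> carrier X; y \<in> carrier X\<rbrakk> \<Longrightarrow> (vadd X x y, vadd X y x) \<in> R"
    and add_zero: "x \<in> carrier X \<Longrightarrow> (vadd X (vzero X) x, x) \<in> R"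
    and add_inverse: "x \<in> carrier X \<Longrightarrow> \<exists>y\<in>carrier X. (vadd X x y, vzero X) \<in> R"
    and scale_add_right: "\<lbrakk>x \<in> carrier X; y \<in> carrier X\<rbrakk>
      \<Longrightarrow> (vscale X c (vadd X x y), vadd X (vscale X c x) (vscale X c y)) \<in> R"
    and scale_add_left: "x \<in> carrier X
      \<Longrightarrow> (vscale X (c + d) x, vadd X (vscale X c x) (vscale X d x)) \<in> R"
    and scale_scale: "x \<in> carrier X \<Longrightarrow> (vscale X c (vscale X d x), vscale X (c * d) x) \<in> R"
    and scale_one: "x \<in> carrier X \<Longrightarrow> (vscale X 1 x, x) \<in> R"
    and norm_nonneg: "x \<in> carrier X \<Longrightarrow> 0 \<le> vnorm X x"
    and norm_triangle: "\<lbrakk>x \<in> carrier X; y \<in> carrier X\<rbrakk>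
      \<Longrightarrow> vnorm X (vadd X x y) \<le> vnorm X x + vnorm X y"
    and norm_scale: "x \<in> carrier X \<Longrightarrow> vnorm X (vscale X c x) = \<bar>c\<bar> * vnorm X x"
begin

lemma quotient_carrier_iff:
  "A \<in> carrier (quotient_structure X R) \<longleftrightarrow> (\<exists>x\<in>carrier X. A = R `` {x})"
  by (auto simp: quotient_structure_def quotient_def)

lemma quotient_closed: "x \<in> carrier X \<Longrightarrow> R `` {x} \<in> carrier (quotient_structure X R)"
  using quotient_carrier_iff by blast

lemma class_eq: "(x, y) \<in> R \<Longrightarrow> R `` {x} = R `` {y}"
  by (rule equiv_class_eq[OF equiv])

lemma quotient_vzero: "vzero (quotient_structure X R) = R `` {vzero X}"
  by (simp add: quotient_structure_def)

lemma quotient_vadd: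
  assumes "x \<in> carrier X" "y \<in> carrier X"
  shows "vadd (quotient_structure X R) (R `` {x}) (R `` {y}) = R `` {vadd X x y}"
proof -
  have "congruent2 R R (\<lambda>x y. R `` {vadd X x y})"
    by (rule congruent2I') (rule class_eq[OF add_cong])
  from UN_equiv_class2[OF equiv equiv this assms] show ?thesis
    by (simp add: quotient_structure_def)
qed

lemma quotient_vscale:
  assumes "x \<in> carrier X"
  shows "vscale (quotient_structure X R) c (R `` {x}) = R `` {vscale X c x}"
proof -
  have "congruent R (\<lambda>x. R `` {vscale X c x})"
    by (rule congruentI) (rule class_eq[OF scale_cong])
  from UN_equiv_class[OF equiv this assms] show ?thesis
    by (simp add: quotient_structure_def)
qed

lemma quotient_vnorm:
  assumes "x \<in> carrier X"
  shows "vnorm (quotient_structure X R) (R `` {x}) = vnorm X x"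
proof -
  have "the_elem (vnorm X ` (R `` {x})) = vnorm X x"
  proof (rule the_elem_image_unique)
    show "R `` {x} \<noteq> {}" using equiv_class_self[OF equiv assms] by blast
    show "vnorm X y = vnorm X x" if "y \<in> R `` {x}" for y
      using that norm_cong[of x y] by simp
  qed
  then show ?thesis by (simp add: quotient_structure_def)
qed

lemmas quotient_simps = quotient_vzero quotient_vadd quotient_vscale quotient_vnorm
  zero_closed add_closed scale_closed

lemma seminormed_space_quotient: "seminormed_space (quotient_structure X R)"
proof
  show "\<exists>B\<in>carrier (quotient_structure X R).
      vadd (quotient_structure X R) A B = vzero (quotient_structure X R)"
    if A: "A \<in> carrier (quotient_structure X R)" for A
  proof -
    obtain x where x: "x \<in> carrier X" "A = R `` {x}" using A quotient_carrier_iff by blast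
    obtain y where y: "y \<in> carrier X" "(vadd X x y, vzero X) \<in> R" using add_inverse[OF x(1)] by blast
    show ?thesis
      using x y class_eq[OF y(2)] by (intro bexI[OF _ quotient_closed[OF y(1)]]) (simp add: quotient_simps)
  qed
  show "vzero (quotient_structure X R) \<in> carrier (quotient_structure X R)"
    by (simp add: quotient_simps quotient_closed)
  show "vadd (quotient_structure X R) A B \<in> carrier (quotient_structure X R)"
    if "A \<in> carrier (quotient_structure X R)" "B \<in> carrier (quotient_structure X R)" for A B
    using that unfolding quotient_carrier_iff[of A] quotient_carrier_iff[of B]
    by (auto simp: quotient_simps quotient_closed)
  show "vscale (quotient_structure X R) c A \<in> carrier (quotient_structure X R)"
    if "A \<in> carrier (quotient_structure X R)" for c A
    using that unfolding quotient_carrier_iff[of A]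
    by (auto simp: quotient_simps quotient_closed)
  show "vadd (quotient_structure X R) A B = vadd (quotient_structure X R) B A"
    if "A \<in> carrier (quotient_structure X R)" "B \<in> carrier (quotient_structure X R)" for A B
    using that class_eq[OF add_commute] by (auto simp: quotient_carrier_iff quotient_simps)
qed (auto simp: quotient_carrier_iff quotient_simps norm_nonneg norm_triangle norm_scale
    class_eq[OF add_assoc] class_eq[OF add_zero]
    class_eq[OF scale_add_right] class_eq[OF scale_add_left] class_eq[OF scale_scale]
    class_eq[OF scale_one])

lemma vlinear_quotient: "vlinear X (quotient_structure X R) (\<lambda>x. R `` {x})"
  by (auto simp: vlinear_def quotient_closed quotient_simps)

end

context seminormed_space
begin

lemma null_rel_iff:
  "(x, y) \<in> null_rel X \<longleftrightarrow> x \<in> carrier X \<and> y \<in> carrier X \<and> vnorm X (vminus X x y) = 0"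
  by (simp add: null_rel_def)

lemma null_rel_refl: "x \<in> carrier X \<Longrightarrow> (x, x) \<in> null_rel X"
  by (simp add: null_rel_iff minus_self norm_zero)

lemma seminormed_setoid_null_rel: "seminormed_setoid X (null_rel X)"
proof
  have "trans (null_rel X)"
  proof (rule transI)
    fix x y z assume "(x, y) \<in> null_rel X" "(y, z) \<in> null_rel X"
    then show "(x, z) \<in> null_rel X"
      using norm_minus_triangle[of x y z] norm_nonneg[OF minus_closed[of x z]]
      by (simp add: null_rel_iff)
  qed
  moreover have "null_rel X \<subseteq> carrier X \<times> carrier X" by (auto simp: null_rel_iff)
  moreover have "refl_on (carrier X) (null_rel X)" using null_rel_refl by (auto simp: refl_on_def)
  moreover have "sym (null_rel X)"
    using norm_minus_commute by (auto simp: sym_def null_rel_iff)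
  ultimately show "equiv (carrier X) (null_rel X)" by (rule equivI[rotated 3])
  show "(vadd X x y, vadd X x' y') \<in> null_rel X"
    if "(x, x') \<in> null_rel X" "(y, y') \<in> null_rel X" for x x' y y'
    using that norm_triangle[of "vminus X x x'" "vminus X y y'"]
      norm_nonneg[of "vadd X (vminus X x x') (vminus X y y')"]
    by (simp add: null_rel_iff add_minus_add minus_closed closed)
  show "(vscale X c x, vscale X c x') \<in> null_rel X" if "(x, x') \<in> null_rel X" for c x x'
    using that by (simp add: null_rel_iff scale_minus[symmetric] minus_closed closed norm_scale)
  show "vnorm X x = vnorm X x'" if "(x, x') \<in> null_rel X" for x x'
    using that abs_norm_diff_le[of x x'] by (simp add: null_rel_iff)
  show "\<exists>y\<in>carrier X. (vadd X x y, vzero X) \<in> null_rel X" if x: "x \<in> carrier X" for x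
    using add_inverse[OF x] null_rel_refl[OF zero_closed] by force
  show "(vscale X (c + d) x, vadd X (vscale X c x) (vscale X d x)) \<in> null_rel X"
    if "x \<in> carrier X" for c d x
    using that null_rel_refl[of "vscale X (c + d) x"] by (simp add: scale_add_left closed)
qed (simp_all add: closed add_ac add_zero add_zero_right scale_add_right scale_scale scale_one null_rel_refl
    norm_nonneg norm_triangle norm_scale)

lemma normed_space_separated_quotient: "normed_space (separated_quotient X)"
proof -
  interpret Q: seminormed_setoid X "null_rel X" by (rule seminormed_setoid_null_rel)
  interpret S: seminormed_space "separated_quotient X"
    unfolding separated_quotient_def by (rule Q.seminormed_space_quotient)
  have "vnorm (separated_quotient X) A = 0 \<longleftrightarrow> A = vzero (separated_quotient X)"
    if A: "A \<in> carrier (separated_quotient X)" for A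
  proof -
    obtain x where x: "x \<in> carrier X" "A = null_rel X `` {x}"
      using A Q.quotient_carrier_iff by (auto simp: separated_quotient_def)
    have "A = vzero (separated_quotient X) \<longleftrightarrow> (x, vzero X) \<in> null_rel X"
      using eq_equiv_class_iff[OF Q.equiv x(1) zero_closed]
      by (simp add: x(2) separated_quotient_def Q.quotient_simps)
    then show ?thesis
      using x by (simp add: separated_quotient_def Q.quotient_simps null_rel_iff minus_zero zero_closed)
  qed
  then show ?thesis
    by (rule normed_spaceI[OF S.seminormed_space_axioms])
qed

lemma separated_quotient_vlinear: "vlinear X (separated_quotient X) (\<lambda>x. null_rel X `` {x})"
  unfolding separated_quotient_def
  by (rule seminormed_setoid.vlinear_quotient[OF seminormed_setoid_null_rel])

lemma separated_quotient_vnorm: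
  "x \<in> carrier X \<Longrightarrow> vnorm (separated_quotient X) (null_rel X `` {x}) = vnorm X x"
  unfolding separated_quotient_def
  by (rule seminormed_setoid.quotient_vnorm[OF seminormed_setoid_null_rel])

lemma separated_quotient_surj:
  assumes "A \<in> carrier (separated_quotient X)"
  obtains x where "x \<in> carrier X" "A = null_rel X `` {x}"
  using assms seminormed_setoid.quotient_carrier_iff[OF seminormed_setoid_null_rel]
  unfolding separated_quotient_def by blast

end

context normed_space
begin

lemma cauchy_carrier_iff:
  "s \<in> carrier (cauchy_sequences X) \<longleftrightarrow> (\<forall>n. s n \<in> carrier X) \<and>
    (\<forall>\<epsilon>>0. \<exists>N. \<forall>n\<ge>N. \<forall>m\<ge>N. vnorm X (vminus X (s n) (s m)) < \<epsilon>)"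
proof -
  have "(\<forall>n. s n \<in> carrier X) \<Longrightarrow> vdist X (s n) (s m) = vnorm X (vminus X (s n) (s m))" for n m
    by (simp add: vdist_def)
  then show ?thesis
    by (auto simp: cauchy_sequences_def Metric_space.MCauchy_def[OF Metric_space_vdist] image_subset_iff)
qed

lemma
  shows cauchy_vzero: "vzero (cauchy_sequences X) = (\<lambda>n. vzero X)"
    and cauchy_vadd: "vadd (cauchy_sequences X) s t = (\<lambda>n. vadd X (s n) (t n))"
    and cauchy_vscale: "vscale (cauchy_sequences X) c s = (\<lambda>n. vscale X c (s n))"
  by (simp_all add: cauchy_sequences_def)

lemma cauchy_norm_tendsto:
  assumes "s \<in> carrier (cauchy_sequences X)"
  shows "(\<lambda>n. vnorm X (s n)) \<longlonglongrightarrow> vnorm (cauchy_sequences X) s"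
proof -
  have "Cauchy (\<lambda>n. vnorm X (s n))"
  proof (rule metric_CauchyI)
    fix \<epsilon> :: real assume "0 < \<epsilon>"
    then obtain N where N: "\<forall>n\<ge>N. \<forall>m\<ge>N. vnorm X (vminus X (s n) (s m)) < \<epsilon>"
      using assms unfolding cauchy_carrier_iff by blast
    have "dist (vnorm X (s n)) (vnorm X (s m)) < \<epsilon>" if "n \<ge> N" "m \<ge> N" for n m
      using N that abs_norm_diff_le[of "s n" "s m"] assms
      by (force simp: dist_real_def cauchy_carrier_iff)
    then show "\<exists>N. \<forall>m\<ge>N. \<forall>n\<ge>N. dist (vnorm X (s m)) (vnorm X (s n)) < \<epsilon>" by blast
  qed
  then have "convergent (\<lambda>n. vnorm X (s n))" by (simp add: Cauchy_convergent_iff)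
  then show ?thesis by (simp add: cauchy_sequences_def convergent_LIMSEQ_iff)
qed

lemma cauchy_add_closed:
  assumes s: "s \<in> carrier (cauchy_sequences X)" and t: "t \<in> carrier (cauchy_sequences X)"
  shows "vadd (cauchy_sequences X) s t \<in> carrier (cauchy_sequences X)"
  unfolding cauchy_carrier_iff
proof (intro conjI allI impI)
  have c: "s n \<in> carrier X" "t n \<in> carrier X" for n using s t by (auto simp: cauchy_carrier_iff)
  then show "vadd (cauchy_sequences X) s t n \<in> carrier X" for n by (simp add: cauchy_vadd closed)
  fix \<epsilon> :: real assume "0 < \<epsilon>"
  then have e: "0 < \<epsilon> / 2" by simp
  obtain N where N: "\<forall>n\<ge>N. \<forall>m\<ge>N. vnorm X (vminus X (s n) (s m)) < \<epsilon> / 2"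
    using s e unfolding cauchy_carrier_iff by blast
  obtain M where M: "\<forall>n\<ge>M. \<forall>m\<ge>M. vnorm X (vminus X (t n) (t m)) < \<epsilon> / 2"
    using t e unfolding cauchy_carrier_iff by blast
  have "vnorm X (vminus X (vadd X (s n) (t n)) (vadd X (s m) (t m))) < \<epsilon>"
    if "n \<ge> max N M" "m \<ge> max N M" for n m
  proof -
    have "vnorm X (vminus X (s n) (s m)) < \<epsilon> / 2" "vnorm X (vminus X (t n) (t m)) < \<epsilon> / 2"
      using N M that by auto
    then show ?thesis
      using norm_triangle[OF minus_closed[OF c(1) c(1)] minus_closed[OF c(2) c(2)], of n m n m]
      by (simp add: add_minus_add c)
  qed
  then show "\<exists>N. \<forall>n\<ge>N. \<forall>m\<ge>N. vnorm X (vminus X (vadd (cauchy_sequences X) s t n)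
      (vadd (cauchy_sequences X) s t m)) < \<epsilon>"
    unfolding cauchy_vadd by blast
qed

lemma cauchy_scale_closed:
  assumes s: "s \<in> carrier (cauchy_sequences X)"
  shows "vscale (cauchy_sequences X) c s \<in> carrier (cauchy_sequences X)"
  unfolding cauchy_carrier_iff
proof (intro conjI allI impI)
  have c: "s n \<in> carrier X" for n using s by (auto simp: cauchy_carrier_iff)
  then show "vscale (cauchy_sequences X) c s n \<in> carrier X" for n by (simp add: cauchy_vscale closed)
  fix \<epsilon> :: real assume "0 < \<epsilon>"
  then have e: "0 < \<epsilon> / (\<bar>c\<bar> + 1)" by simp
  obtain N where N: "\<forall>n\<ge>N. \<forall>m\<ge>N. vnorm X (vminus X (s n) (s m)) < \<epsilon> / (\<bar>c\<bar> + 1)"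
    using s e unfolding cauchy_carrier_iff by blast
  have "vnorm X (vminus X (vscale X c (s n)) (vscale X c (s m))) < \<epsilon>"
    if "n \<ge> N" "m \<ge> N" for n m
  proof -
    have "\<bar>c\<bar> * vnorm X (vminus X (s n) (s m)) \<le> (\<bar>c\<bar> + 1) * vnorm X (vminus X (s n) (s m))"
      using norm_nonneg[OF minus_closed[OF c c]] by (intro mult_right_mono) auto
    also have "\<dots> < \<epsilon>"
      using N that by (simp add: pos_less_divide_eq mult.commute)
    finally show ?thesis by (simp add: scale_minus[symmetric] norm_scale c minus_closed)
  qed
  then show "\<exists>N. \<forall>n\<ge>N. \<forall>m\<ge>N. vnorm X (vminus X (vscale (cauchy_sequences X) c s n)
      (vscale (cauchy_sequences X) c s m)) < \<epsilon>"
    unfolding cauchy_vscale by blast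
qed

lemma cauchy_const_closed: "x \<in> carrier X \<Longrightarrow> (\<lambda>n. x) \<in> carrier (cauchy_sequences X)"
  by (simp add: cauchy_carrier_iff minus_self norm_zero)

lemma seminormed_space_cauchy_sequences: "seminormed_space (cauchy_sequences X)"
proof
  let ?C = "cauchy_sequences X"
  note eqs = cauchy_vzero cauchy_vadd cauchy_vscale
  have c: "s n \<in> carrier X" if "s \<in> carrier ?C" for s n
    using that by (auto simp: cauchy_carrier_iff)
  show "vadd ?C (vadd ?C s t) u = vadd ?C s (vadd ?C t u)"
    if "s \<in> carrier ?C" "t \<in> carrier ?C" "u \<in> carrier ?C" for s t u
    using that by (simp add: eqs add_assoc c)
  show "vadd ?C s t = vadd ?C t s" if "s \<in> carrier ?C" "t \<in> carrier ?C" for s t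
    unfolding eqs using add_commute[OF c[OF that(1)] c[OF that(2)]] by blast
  show "vadd ?C (vzero ?C) s = s" if "s \<in> carrier ?C" for s
    using that by (simp add: eqs add_zero c)
  show "\<exists>t\<in>carrier ?C. vadd ?C s t = vzero ?C" if "s \<in> carrier ?C" for s
    using that by (intro bexI[OF _ cauchy_scale_closed[OF that, of "-1"]])
      (simp add: eqs add_negative c)
  show "vscale ?C a (vadd ?C s t) = vadd ?C (vscale ?C a s) (vscale ?C a t)"
    if "s \<in> carrier ?C" "t \<in> carrier ?C" for a s t
    using that by (simp add: eqs scale_add_right c)
  show "vscale ?C (a + b) s = vadd ?C (vscale ?C a s) (vscale ?C b s)"
    if "s \<in> carrier ?C" for a b s
    using that by (simp add: eqs scale_add_left c)
  show "vscale ?C a (vscale ?C b s) = vscale ?C (a * b) s" if "s \<in> carrier ?C" for a b s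
    using that by (simp add: eqs scale_scale c)
  show "vscale ?C 1 s = s" if "s \<in> carrier ?C" for s
    using that by (simp add: eqs scale_one c)
  show "0 \<le> vnorm ?C s" if "s \<in> carrier ?C" for s
    using cauchy_norm_tendsto[OF that] norm_nonneg[OF c[OF that]] by (intro LIMSEQ_le_const) auto
  show "vnorm ?C (vadd ?C s t) \<le> vnorm ?C s + vnorm ?C t"
    if st: "s \<in> carrier ?C" "t \<in> carrier ?C" for s t
  proof (rule LIMSEQ_le)
    show "(\<lambda>n. vnorm X (vadd ?C s t n)) \<longlonglongrightarrow> vnorm ?C (vadd ?C s t)"
      by (intro cauchy_norm_tendsto cauchy_add_closed st)
    show "(\<lambda>n. vnorm X (s n) + vnorm X (t n)) \<longlonglongrightarrow> vnorm ?C s + vnorm ?C t"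
      by (intro tendsto_add cauchy_norm_tendsto st)
  qed (use st c norm_triangle in \<open>auto simp: cauchy_vadd\<close>)
  show "vnorm ?C (vscale ?C a s) = \<bar>a\<bar> * vnorm ?C s" if s: "s \<in> carrier ?C" for a s
  proof (rule LIMSEQ_unique)
    show "(\<lambda>n. vnorm X (vscale ?C a s n)) \<longlonglongrightarrow> vnorm ?C (vscale ?C a s)"
      by (intro cauchy_norm_tendsto cauchy_scale_closed s)
    show "(\<lambda>n. vnorm X (vscale ?C a s n)) \<longlonglongrightarrow> \<bar>a\<bar> * vnorm ?C s"
      using tendsto_mult_left[OF cauchy_norm_tendsto[OF s], of "\<bar>a\<bar>"] s
      by (simp add: cauchy_vscale norm_scale c)
  qed
  show "vzero ?C \<in> carrier ?C"
    unfolding cauchy_vzero by (rule cauchy_const_closed[OF zero_closed])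
qed (rule cauchy_add_closed cauchy_scale_closed; assumption)+

lemma cauchy_const_vlinear: "vlinear X (cauchy_sequences X) (\<lambda>x n. x)"
  by (simp add: vlinear_def cauchy_const_closed cauchy_vadd cauchy_vscale)

lemma cauchy_const_vnorm: "vnorm (cauchy_sequences X) (\<lambda>n. x) = vnorm X x"
  by (simp add: cauchy_sequences_def)

lemma normed_space_completion: "normed_space (norm_completion X)"
  unfolding norm_completion_def
  by (rule seminormed_space.normed_space_separated_quotient[OF seminormed_space_cauchy_sequences])

definition to_completion :: "'a \<Rightarrow> (nat \<Rightarrow> 'a) set" where
  "to_completion x = null_rel (cauchy_sequences X) `` {\<lambda>n. x}"

lemma to_completion_vlinear: "vlinear X (norm_completion X) to_completion"
  unfolding norm_completion_def to_completion_def
  by (rule vlinear_comp[OF cauchy_const_vlinear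
    seminormed_space.separated_quotient_vlinear[OF seminormed_space_cauchy_sequences]])

lemma to_completion_vnorm:
  "x \<in> carrier X \<Longrightarrow> vnorm (norm_completion X) (to_completion x) = vnorm X x"
  using seminormed_space.separated_quotient_vnorm[OF seminormed_space_cauchy_sequences
      cauchy_const_closed]
  by (simp add: norm_completion_def to_completion_def cauchy_const_vnorm)

text \<open>A Cauchy sequence is approximated by the constant sequences at its late terms.\<close>

lemma to_completion_dense:
  assumes A: "A \<in> carrier (norm_completion X)" and \<epsilon>: "0 < \<epsilon>"
  obtains x where "x \<in> carrier X"
    "vnorm (norm_completion X) (vminus (norm_completion X) A (to_completion x)) < \<epsilon>"
proof -
  interpret S: seminormed_space "cauchy_sequences X" by (rule seminormed_space_cauchy_sequences)
  obtain s where s: "s \<in> carrier (cauchy_sequences X)" "A = null_rel (cauchy_sequences X) `` {s}"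
    using A S.separated_quotient_surj unfolding norm_completion_def by blast
  then obtain N where N: "\<forall>n\<ge>N. \<forall>m\<ge>N. vnorm X (vminus X (s n) (s m)) < \<epsilon> / 2"
    using \<epsilon> unfolding cauchy_carrier_iff by (meson half_gt_zero)
  have c: "s n \<in> carrier X" for n using s by (auto simp: cauchy_carrier_iff)
  let ?d = "vminus (cauchy_sequences X) s (\<lambda>n. s N)"
  have d: "?d \<in> carrier (cauchy_sequences X)"
    by (intro S.minus_closed s cauchy_const_closed c)
  have "vnorm (norm_completion X) (vminus (norm_completion X) A (to_completion (s N))) =
      vnorm (cauchy_sequences X) ?d"
    using vlinear_minus[OF seminormed_space_cauchy_sequences S.separated_quotient_vlinear s(1)
        cauchy_const_closed[OF c]] S.separated_quotient_vnorm[OF d]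
    by (simp add: s(2) norm_completion_def to_completion_def)
  also have "\<dots> \<le> \<epsilon> / 2"
  proof (rule LIMSEQ_le_const2[OF cauchy_norm_tendsto[OF d]])
    have "vnorm X (?d n) \<le> \<epsilon> / 2" if "n \<ge> N" for n
      using N that by (simp add: vminus_def cauchy_vadd cauchy_vscale less_imp_le)
    then show "\<exists>N. \<forall>n\<ge>N. vnorm X (?d n) \<le> \<epsilon> / 2" by blast
  qed
  also have "\<dots> < \<epsilon>" using \<epsilon> by simp
  finally show ?thesis using that c by blast
qed

end


section \<open>Direct limits\<close>

locale direct_system =
  fixes E :: "nat \<Rightarrow> 'a vstruct" and \<iota> :: "nat \<Rightarrow> 'a \<Rightarrow> 'a"
  assumes stage: "seminormed_space (E i)"
    and map_vlinear: "vlinear (E i) (E (Suc i)) (\<iota> i)"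
    and map_contractive: "x \<in> carrier (E i) \<Longrightarrow> vnorm (E (Suc i)) (\<iota> i x) \<le> vnorm (E i) x"
begin

lemma bond_self: "bond \<iota> i i x = x"
  by (simp add: bond_def)

lemma bond_Suc: "i \<le> j \<Longrightarrow> bond \<iota> i (Suc j) x = \<iota> j (bond \<iota> i j x)"
  by (simp add: bond_def)

lemma bond_bond:
  assumes "i \<le> j" "j \<le> k"
  shows "bond \<iota> j k (bond \<iota> i j x) = bond \<iota> i k x"
  using assms(2) by (induction k rule: dec_induct) (use assms(1) in \<open>simp_all add: bond_self bond_Suc\<close>)

lemma bond_vlinear: "i \<le> j \<Longrightarrow> vlinear (E i) (E j) (bond \<iota> i j)"
proof (induction j rule: dec_induct)
  case base
  show ?case using vlinear_id by (simp add: bond_self vlinear_def)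
next
  case (step j)
  then show ?case
    using vlinear_comp[OF step.IH map_vlinear[of j]] by (simp add: bond_Suc vlinear_def)
qed

lemmas bond_closed = vlinear_closed[OF bond_vlinear]
lemmas bond_add = vlinear_add[OF bond_vlinear]
lemmas bond_scale = vlinear_scale[OF bond_vlinear]

lemma bond_zero: "i \<le> j \<Longrightarrow> bond \<iota> i j (vzero (E i)) = vzero (E j)"
  using bond_scale[of i j "vzero (E i)" 0] bond_closed[of i j "vzero (E i)"]
    seminormed_space.scale_zero_left[OF stage] seminormed_space.zero_closed[OF stage]
  by metis

lemma bond_norm_tendsto:
  assumes "x \<in> carrier (E i)"
  shows "(\<lambda>j. vnorm (E j) (bond \<iota> i j x)) \<longlonglongrightarrow> lim (\<lambda>j. vnorm (E j) (bond \<iota> i j x))"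
proof -
  let ?f = "\<lambda>j. vnorm (E j) (bond \<iota> i j x)"
  have "decseq (\<lambda>k. ?f (k + i))"
    using map_contractive[OF bond_closed[OF _ assms]] by (intro decseq_SucI) (simp add: bond_Suc)
  moreover have "0 \<le> ?f (k + i)" for k
    by (intro seminormed_space.norm_nonneg[OF stage] bond_closed assms) simp
  ultimately have "convergent (\<lambda>k. ?f (k + i))"
    using decseq_convergent[of "\<lambda>k. ?f (k + i)" 0] convergent_def by blast
  then have "convergent ?f" by (rule convergent_ignore_initial_segment[THEN iffD1])
  then show ?thesis by (simp add: convergent_LIMSEQ_iff)
qed

abbreviation "germs \<equiv> disjoint_union E \<iota>"

definition at_stage :: "nat \<Rightarrow> nat \<times> 'a \<Rightarrow> 'a" where
  "at_stage n p = bond \<iota> (fst p) n (snd p)"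

lemma germs_carrier_iff: "p \<in> carrier germs \<longleftrightarrow> snd p \<in> carrier (E (fst p))"
  by (cases p) (simp add: disjoint_union_def)

lemma germs_vzero: "vzero germs = (0, vzero (E 0))"
  by (simp add: disjoint_union_def)

lemma
  shows fst_germs_vadd: "fst (vadd germs p q) = max (fst p) (fst q)"
    and snd_germs_vadd: "snd (vadd germs p q) = vadd (E (max (fst p) (fst q)))
      (at_stage (max (fst p) (fst q)) p) (at_stage (max (fst p) (fst q)) q)"
  by (simp_all add: disjoint_union_def Let_def at_stage_def split: prod.split)

lemma
  shows fst_germs_vscale: "fst (vscale germs c p) = fst p"
    and snd_germs_vscale: "snd (vscale germs c p) = vscale (E (fst p)) c (snd p)"
  by (simp_all add: disjoint_union_def split: prod.split)

lemma at_stage_closed: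
  "\<lbrakk>p \<in> carrier germs; fst p \<le> n\<rbrakk> \<Longrightarrow> at_stage n p \<in> carrier (E n)"
  by (simp add: at_stage_def germs_carrier_iff bond_closed)

lemma bond_at_stage:
  "\<lbrakk>fst p \<le> n; n \<le> m\<rbrakk> \<Longrightarrow> bond \<iota> n m (at_stage n p) = at_stage m p"
  by (simp add: at_stage_def bond_bond)

lemma germs_add_closed:
  "\<lbrakk>p \<in> carrier germs; q \<in> carrier germs\<rbrakk> \<Longrightarrow> vadd germs p q \<in> carrier germs"
  unfolding germs_carrier_iff[of "vadd germs p q"] fst_germs_vadd snd_germs_vadd
  by (intro seminormed_space.add_closed[OF stage] at_stage_closed) auto

lemma germs_scale_closed: "p \<in> carrier germs \<Longrightarrow> vscale germs c p \<in> carrier germs"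
  by (simp add: germs_carrier_iff fst_germs_vscale snd_germs_vscale
    seminormed_space.scale_closed[OF stage])

lemma germs_zero_closed: "vzero germs \<in> carrier germs"
  by (simp add: germs_carrier_iff germs_vzero seminormed_space.zero_closed[OF stage])

lemma at_stage_add:
  assumes "p \<in> carrier germs" "q \<in> carrier germs" "fst p \<le> n" "fst q \<le> n"
  shows "at_stage n (vadd germs p q) = vadd (E n) (at_stage n p) (at_stage n q)"
  unfolding at_stage_def[of n "vadd germs p q"] fst_germs_vadd snd_germs_vadd
  using assms by (subst bond_add) (simp_all add: at_stage_closed bond_at_stage)

lemma at_stage_scale:
  assumes "p \<in> carrier germs" "fst p \<le> n"
  shows "at_stage n (vscale germs c p) = vscale (E n) c (at_stage n p)"
  using assms by (simp add: at_stage_def fst_germs_vscale snd_germs_vscale bond_scale germs_carrier_iff)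

lemma at_stage_zero: "at_stage n (vzero germs) = vzero (E n)"
  by (simp add: at_stage_def germs_vzero bond_zero)

lemma germ_rel_iff:
  "(p, q) \<in> germ_rel E \<iota> \<longleftrightarrow> p \<in> carrier germs \<and> q \<in> carrier germs \<and>
     (\<exists>n. fst p \<le> n \<and> fst q \<le> n \<and> at_stage n p = at_stage n q)"
  by (cases p; cases q) (auto simp: germ_rel_def germs_carrier_iff at_stage_def)

lemma germ_relI:
  assumes "p \<in> carrier germs" "q \<in> carrier germs" "fst p \<le> n" "fst q \<le> n"
    "at_stage n p = at_stage n q"
  shows "(p, q) \<in> germ_rel E \<iota>"
  using assms germ_rel_iff by blast

lemma germ_rel_later:
  assumes "(p, q) \<in> germ_rel E \<iota>"
  obtains n where "\<And>m. n \<le> m \<Longrightarrow> fst p \<le> m \<and> fst q \<le> m \<and> at_stage m p = at_stage m q"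
proof -
  obtain n where n: "fst p \<le> n" "fst q \<le> n" "at_stage n p = at_stage n q"
    using assms unfolding germ_rel_iff by blast
  have "at_stage m p = at_stage m q" if "n \<le> m" for m
    using n that bond_at_stage by metis
  then show ?thesis using n that by (meson order_trans)
qed

lemma germs_norm_tendsto:
  "p \<in> carrier germs \<Longrightarrow> (\<lambda>n. vnorm (E n) (at_stage n p)) \<longlonglongrightarrow> vnorm germs p"
  using bond_norm_tendsto[of "snd p" "fst p"]
  by (cases p) (simp add: germs_carrier_iff disjoint_union_def at_stage_def)

lemma equiv_germ_rel: "equiv (carrier germs) (germ_rel E \<iota>)"
proof (rule equivI)
  show "germ_rel E \<iota> \<subseteq> carrier germs \<times> carrier germs"
    by (auto simp: germ_rel_iff)
  show "refl_on (carrier germs) (germ_rel E \<iota>)"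
    using germ_relI[OF _ _ order_refl order_refl refl] by (intro refl_onI)
  show "sym (germ_rel E \<iota>)"
    by (rule symI) (auto simp: germ_rel_iff)
  show "trans (germ_rel E \<iota>)"
  proof (rule transI)
    fix p q r assume pq: "(p, q) \<in> germ_rel E \<iota>" and qr: "(q, r) \<in> germ_rel E \<iota>"
    obtain n where n: "\<And>m. n \<le> m \<Longrightarrow> fst p \<le> m \<and> fst q \<le> m \<and> at_stage m p = at_stage m q"
      using germ_rel_later[OF pq] by blast
    obtain k where k: "\<And>m. k \<le> m \<Longrightarrow> fst q \<le> m \<and> fst r \<le> m \<and> at_stage m q = at_stage m r"
      using germ_rel_later[OF qr] by blast
    show "(p, r) \<in> germ_rel E \<iota>"
      using pq qr n[of "max n k"] k[of "max n k"]
      by (intro germ_relI[of _ _ "max n k"]) (auto simp: germ_rel_iff)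
  qed
qed

text \<open>
  Each axiom is an identity between germs, checked at any stage to which all germs involved
  have been moved; there it is the corresponding axiom of that space.
\<close>

lemma seminormed_setoid_germs: "seminormed_setoid germs (germ_rel E \<iota>)"
proof
  note ops = at_stage_add at_stage_scale at_stage_zero at_stage_closed
    fst_germs_vadd fst_germs_vscale germs_add_closed germs_scale_closed germs_zero_closed
    seminormed_space.closed[OF stage]
  show "(vadd germs p q, vadd germs p' q') \<in> germ_rel E \<iota>"
    if pp: "(p, p') \<in> germ_rel E \<iota>" and qq: "(q, q') \<in> germ_rel E \<iota>" for p p' q q'
  proof -
    obtain n where n: "\<And>m. n \<le> m \<Longrightarrow> fst p \<le> m \<and> fst p' \<le> m \<and> at_stage m p = at_stage m p'"
      using germ_rel_later[OF pp] by blast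
    obtain k where k: "\<And>m. k \<le> m \<Longrightarrow> fst q \<le> m \<and> fst q' \<le> m \<and> at_stage m q = at_stage m q'"
      using germ_rel_later[OF qq] by blast
    have "p \<in> carrier germs" "p' \<in> carrier germs" "q \<in> carrier germs" "q' \<in> carrier germs"
      using pp qq by (simp_all add: germ_rel_iff)
    then show ?thesis
      using n[of "max n k"] k[of "max n k"] by (intro germ_relI[of _ _ "max n k"]) (simp_all add: ops)
  qed
  show "(vscale germs c p, vscale germs c p') \<in> germ_rel E \<iota>"
    if pp: "(p, p') \<in> germ_rel E \<iota>" for c p p'
  proof -
    obtain n where n: "\<And>m. n \<le> m \<Longrightarrow> fst p \<le> m \<and> fst p' \<le> m \<and> at_stage m p = at_stage m p'"
      using germ_rel_later[OF pp] by blast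
    have "p \<in> carrier germs" "p' \<in> carrier germs" using pp by (simp_all add: germ_rel_iff)
    then show ?thesis
      using n[of n] by (intro germ_relI[of _ _ n]) (simp_all add: ops)
  qed
  show "vnorm germs p = vnorm germs p'" if pp: "(p, p') \<in> germ_rel E \<iota>" for p p'
  proof (rule LIMSEQ_unique)
    obtain n where n: "\<And>m. n \<le> m \<Longrightarrow> fst p \<le> m \<and> fst p' \<le> m \<and> at_stage m p = at_stage m p'"
      using germ_rel_later[OF pp] by blast
    show "(\<lambda>n. vnorm (E n) (at_stage n p)) \<longlonglongrightarrow> vnorm germs p"
      using pp by (intro germs_norm_tendsto) (simp add: germ_rel_iff)
    have "(\<lambda>n. vnorm (E n) (at_stage n p')) \<longlonglongrightarrow> vnorm germs p'"
      using pp by (intro germs_norm_tendsto) (simp add: germ_rel_iff)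
    then show "(\<lambda>n. vnorm (E n) (at_stage n p)) \<longlonglongrightarrow> vnorm germs p'"
      by (rule Lim_transform_eventually)
        (use n in \<open>auto simp: eventually_sequentially intro!: exI[of _ n]\<close>)
  qed
  show "(vadd germs (vadd germs p q) r, vadd germs p (vadd germs q r)) \<in> germ_rel E \<iota>"
    if "p \<in> carrier germs" "q \<in> carrier germs" "r \<in> carrier germs" for p q r
  proof -
    obtain n where "fst p \<le> n" "fst q \<le> n" "fst r \<le> n"
      by (meson nat_le_linear order_trans)
    then show ?thesis
      using that by (intro germ_relI[of _ _ n])
        (simp_all add: ops seminormed_space.add_assoc[OF stage])
  qed
  show "(vadd germs p q, vadd germs q p) \<in> germ_rel E \<iota>"
    if "p \<in> carrier germs" "q \<in> carrier germs" for p q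
    using that seminormed_space.add_commute[OF stage[of "max (fst p) (fst q)"]]
    by (intro germ_relI[of _ _ "max (fst p) (fst q)"]) (simp_all add: ops)
  show "(vadd germs (vzero germs) p, p) \<in> germ_rel E \<iota>" if "p \<in> carrier germs" for p
    using that by (intro germ_relI[of _ _ "fst p"])
      (simp_all add: ops seminormed_space.add_zero[OF stage] germs_vzero[THEN arg_cong[of _ _ fst]])
  show "\<exists>q\<in>carrier germs. (vadd germs p q, vzero germs) \<in> germ_rel E \<iota>"
    if p: "p \<in> carrier germs" for p
    using p by (intro bexI[OF _ germs_scale_closed[OF p, of "-1"]] germ_relI[of _ _ "fst p"])
      (simp_all add: ops seminormed_space.add_negative[OF stage] germs_vzero[THEN arg_cong[of _ _ fst]])
  show "(vscale germs c (vadd germs p q), vadd germs (vscale germs c p) (vscale germs c q))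
      \<in> germ_rel E \<iota>" if "p \<in> carrier germs" "q \<in> carrier germs" for c p q
    using that by (intro germ_relI[of _ _ "max (fst p) (fst q)"])
      (simp_all add: ops seminormed_space.scale_add_right[OF stage])
  show "(vscale germs (c + d) p, vadd germs (vscale germs c p) (vscale germs d p)) \<in> germ_rel E \<iota>"
    if "p \<in> carrier germs" for c d p
    using that by (intro germ_relI[of _ _ "fst p"])
      (simp_all add: ops seminormed_space.scale_add_left[OF stage])
  show "(vscale germs c (vscale germs d p), vscale germs (c * d) p) \<in> germ_rel E \<iota>"
    if "p \<in> carrier germs" for c d p
    using that by (intro germ_relI[of _ _ "fst p"])
      (simp_all add: ops seminormed_space.scale_scale[OF stage])
  show "(vscale germs 1 p, p) \<in> germ_rel E \<iota>" if "p \<in> carrier germs" for p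
    using that by (intro germ_relI[of _ _ "fst p"])
      (simp_all add: ops seminormed_space.scale_one[OF stage])
  show "0 \<le> vnorm germs p" if p: "p \<in> carrier germs" for p
    using germs_norm_tendsto[OF p]
    by (rule LIMSEQ_le_const)
      (use p in \<open>auto intro!: exI[of _ "fst p"] seminormed_space.norm_nonneg[OF stage] at_stage_closed\<close>)
  show "vnorm germs (vadd germs p q) \<le> vnorm germs p + vnorm germs q"
    if pq: "p \<in> carrier germs" "q \<in> carrier germs" for p q
  proof (rule LIMSEQ_le)
    show "(\<lambda>n. vnorm (E n) (at_stage n (vadd germs p q))) \<longlonglongrightarrow> vnorm germs (vadd germs p q)"
      by (intro germs_norm_tendsto germs_add_closed pq)
    show "(\<lambda>n. vnorm (E n) (at_stage n p) + vnorm (E n) (at_stage n q))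
        \<longlonglongrightarrow> vnorm germs p + vnorm germs q"
      by (intro tendsto_add germs_norm_tendsto pq)
    show "\<exists>N. \<forall>n\<ge>N. vnorm (E n) (at_stage n (vadd germs p q))
        \<le> vnorm (E n) (at_stage n p) + vnorm (E n) (at_stage n q)"
      using pq by (intro exI[of _ "max (fst p) (fst q)"])
        (auto simp: ops intro!: seminormed_space.norm_triangle[OF stage])
  qed
  show "vnorm germs (vscale germs c p) = \<bar>c\<bar> * vnorm germs p" if p: "p \<in> carrier germs" for c p
  proof (rule LIMSEQ_unique)
    show "(\<lambda>n. vnorm (E n) (at_stage n (vscale germs c p))) \<longlonglongrightarrow> vnorm germs (vscale germs c p)"
      by (intro germs_norm_tendsto germs_scale_closed p)
    have "\<forall>\<^sub>F n in sequentially. \<bar>c\<bar> * vnorm (E n) (at_stage n p) =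
        vnorm (E n) (at_stage n (vscale germs c p))"
      using p unfolding eventually_sequentially
      by (intro exI[of _ "fst p"]) (simp add: ops seminormed_space.norm_scale[OF stage])
    then show "(\<lambda>n. vnorm (E n) (at_stage n (vscale germs c p))) \<longlonglongrightarrow> \<bar>c\<bar> * vnorm germs p"
      using tendsto_mult_left[OF germs_norm_tendsto[OF p]] by (rule Lim_transform_eventually[rotated])
  qed
qed (use equiv_germ_rel germs_zero_closed germs_add_closed germs_scale_closed in auto)

lemma seminormed_space_algebraic_limit: "seminormed_space (algebraic_limit E \<iota>)"
  unfolding algebraic_limit_def
  by (rule seminormed_setoid.seminormed_space_quotient[OF seminormed_setoid_germs])

lemma germ_vlinear: "vlinear (E i) (algebraic_limit E \<iota>) (\<lambda>x. germ_rel E \<iota> `` {(i, x)})"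
proof -
  have "vlinear (E i) germs (\<lambda>x. (i, x))"
    by (auto simp: vlinear_def disjoint_union_def Let_def bond_self)
  from vlinear_comp[OF this seminormed_setoid.vlinear_quotient[OF seminormed_setoid_germs]]
  show ?thesis by (simp add: algebraic_limit_def)
qed

lemma normed_space_direct_limit: "normed_space (direct_limit E \<iota>)"
  unfolding direct_limit_def
  by (intro normed_space.normed_space_completion
    seminormed_space.normed_space_separated_quotient seminormed_space_algebraic_limit)

lemma germ_normed: "normed_space (separated_quotient (algebraic_limit E \<iota>))"
  by (rule seminormed_space.normed_space_separated_quotient[OF seminormed_space_algebraic_limit])

lemma canonical_map_eq:
  "canonical_map E \<iota> i x = normed_space.to_completion (separated_quotient (algebraic_limit E \<iota>))
     (null_rel (algebraic_limit E \<iota>) `` {germ_rel E \<iota> `` {(i, x)}})"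
  by (simp add: canonical_map_def normed_space.to_completion_def[OF germ_normed])

lemma canonical_map_vlinear: "vlinear (E i) (direct_limit E \<iota>) (canonical_map E \<iota> i)"
  using vlinear_comp[OF vlinear_comp[OF germ_vlinear
      seminormed_space.separated_quotient_vlinear[OF seminormed_space_algebraic_limit]]
    normed_space.to_completion_vlinear[OF germ_normed]]
  by (simp add: canonical_map_eq[abs_def] direct_limit_def)

lemma canonical_map_norm_tendsto:
  assumes x: "x \<in> carrier (E i)"
  shows "(\<lambda>j. vnorm (E j) (bond \<iota> i j x)) \<longlonglongrightarrow> vnorm (direct_limit E \<iota>) (canonical_map E \<iota> i x)"
proof -
  have ix: "(i, x) \<in> carrier germs" using x by (simp add: germs_carrier_iff)
  have g: "germ_rel E \<iota> `` {(i, x)} \<in> carrier (algebraic_limit E \<iota>)"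
    by (rule vlinear_closed[OF germ_vlinear x])
  have "vnorm (direct_limit E \<iota>) (canonical_map E \<iota> i x) = vnorm germs (i, x)"
    using normed_space.to_completion_vnorm[OF germ_normed vlinear_closed[OF
          seminormed_space.separated_quotient_vlinear[OF seminormed_space_algebraic_limit] g]]
      seminormed_space.separated_quotient_vnorm[OF seminormed_space_algebraic_limit g]
      seminormed_setoid.quotient_vnorm[OF seminormed_setoid_germs ix]
    by (simp add: canonical_map_eq direct_limit_def algebraic_limit_def)
  then show ?thesis using germs_norm_tendsto[OF ix] by (simp add: at_stage_def)
qed

lemma canonical_map_bond:
  assumes "x \<in> carrier (E i)" "i \<le> j"
  shows "canonical_map E \<iota> j (bond \<iota> i j x) = canonical_map E \<iota> i x"
proof -
  have "((j, bond \<iota> i j x), (i, x)) \<in> germ_rel E \<iota>"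
    using assms by (intro germ_relI[of _ _ j])
      (simp_all add: germs_carrier_iff bond_closed at_stage_def bond_self)
  from equiv_class_eq[OF equiv_germ_rel this] show ?thesis
    by (simp add: canonical_map_def)
qed

lemma canonical_maps_dense:
  assumes A: "A \<in> carrier (direct_limit E \<iota>)" and \<epsilon>: "0 < \<epsilon>"
  obtains i x where "x \<in> carrier (E i)"
    "vnorm (direct_limit E \<iota>) (vminus (direct_limit E \<iota>) A (canonical_map E \<iota> i x)) < \<epsilon>"
proof -
  let ?L = "algebraic_limit E \<iota>"
  obtain B where B: "B \<in> carrier (separated_quotient ?L)"
    "vnorm (direct_limit E \<iota>) (vminus (direct_limit E \<iota>) A
      (normed_space.to_completion (separated_quotient ?L) B)) < \<epsilon>"
    using normed_space.to_completion_dense[OF germ_normed A[unfolded direct_limit_def] \<epsilon>]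
    unfolding direct_limit_def by blast
  obtain b where b: "b \<in> carrier ?L" "B = null_rel ?L `` {b}"
    using seminormed_space.separated_quotient_surj[OF seminormed_space_algebraic_limit B(1)] by blast
  obtain p where p: "p \<in> carrier germs" "b = germ_rel E \<iota> `` {p}"
    using b(1) seminormed_setoid.quotient_carrier_iff[OF seminormed_setoid_germs]
    unfolding algebraic_limit_def by blast
  show ?thesis
    using B(2) p b by (intro that[of "snd p" "fst p"]) (simp_all add: germs_carrier_iff canonical_map_eq)
qed

end


section \<open>Inverse limits\<close>

locale inverse_system =
  fixes W :: "nat \<Rightarrow> 'a vstruct" and \<theta> :: "nat \<Rightarrow> 'a \<Rightarrow> 'a"
  assumes standard: "standard_inverse_system W \<theta>"
begin

lemma
  shows stage: "normed_space (W i)"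
    and stage_finite_dimensional: "finite_dimensional (W i)"
    and map_vlinear: "vlinear (W (Suc i)) (W i) (\<theta> i)"
    and map_contractive: "x \<in> carrier (W (Suc i)) \<Longrightarrow> vnorm (W i) (\<theta> i x) \<le> vnorm (W (Suc i)) x"
  using standard unfolding standard_inverse_system_def banach_space_def by blast+

lemma stage_seminormed: "seminormed_space (W i)"
  by (rule normed_space_imp_seminormed[OF stage])

abbreviation "L \<equiv> inverse_limit W \<theta>"

lemma limit_carrier_iff:
  "w \<in> carrier L \<longleftrightarrow> (\<forall>i. w i \<in> carrier (W i)) \<and> (\<forall>i. \<theta> i (w (Suc i)) = w i) \<and>
     (\<exists>K. \<forall>i. vnorm (W i) (w i) \<le> K)"
  unfolding inverse_limit_def bdd_above_def by auto

lemma
  assumes "w \<in> carrier L"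
  shows limit_stage: "w i \<in> carrier (W i)"
    and limit_map: "\<theta> i (w (Suc i)) = w i"
  using assms by (simp_all add: limit_carrier_iff)

lemma
  shows limit_vzero: "vzero L = (\<lambda>i. vzero (W i))"
    and limit_vadd: "vadd L v w = (\<lambda>i. vadd (W i) (v i) (w i))"
    and limit_vscale: "vscale L c w = (\<lambda>i. vscale (W i) c (w i))"
  by (simp_all add: inverse_limit_def)

lemma limit_vminus: "vminus L v w = (\<lambda>i. vminus (W i) (v i) (w i))"
  by (simp add: vminus_def limit_vadd limit_vscale)

lemma limit_incseq:
  assumes "w \<in> carrier L" shows "incseq (\<lambda>i. vnorm (W i) (w i))"
  using map_contractive[OF limit_stage[OF assms]] by (intro incseq_SucI) (simp add: limit_map[OF assms])

lemma limit_norm_tendsto: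
  assumes "w \<in> carrier L" shows "(\<lambda>i. vnorm (W i) (w i)) \<longlonglongrightarrow> vnorm L w"
proof -
  have "convergent (\<lambda>i. vnorm (W i) (w i))"
    using incseq_convergent[OF limit_incseq[OF assms]] assms
    by (metis convergentI limit_carrier_iff)
  then show ?thesis by (simp add: inverse_limit_def convergent_LIMSEQ_iff)
qed

lemma stage_norm_le: "w \<in> carrier L \<Longrightarrow> vnorm (W i) (w i) \<le> vnorm L w"
  by (rule incseq_le[OF limit_incseq limit_norm_tendsto])

lemma normed_space_inverse_limit: "normed_space L"
proof
  note simps = limit_vzero limit_vadd limit_vscale limit_stage
  interpret W: normed_space "W i" for i by (rule stage)
  have zero: "\<theta> i (vzero (W (Suc i))) = vzero (W i)" for i
    using vlinear_scale[OF map_vlinear W.zero_closed, of i 0]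
      vlinear_closed[OF map_vlinear W.zero_closed, of i]
    by (simp add: W.scale_zero_left W.zero_closed)
  show "vzero L \<in> carrier L"
    unfolding limit_carrier_iff limit_vzero by (auto simp: W.zero_closed W.norm_zero zero)
  show "vadd L v w \<in> carrier L" if vw: "v \<in> carrier L" "w \<in> carrier L" for v w
    unfolding limit_carrier_iff
  proof (intro conjI allI exI)
    show "vadd L v w i \<in> carrier (W i)" for i using vw by (simp add: simps W.closed)
    show "\<theta> i (vadd L v w (Suc i)) = vadd L v w i" for i
      using vw by (simp add: simps vlinear_add[OF map_vlinear] limit_map)
    show "vnorm (W i) (vadd L v w i) \<le> vnorm L v + vnorm L w" for i
      using W.norm_triangle[OF limit_stage[OF vw(1)] limit_stage[OF vw(2)], of i]
        stage_norm_le[OF vw(1), of i] stage_norm_le[OF vw(2), of i]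
      by (simp add: limit_vadd)
  qed
  show "vscale L c w \<in> carrier L" if w: "w \<in> carrier L" for c w
    unfolding limit_carrier_iff
  proof (intro conjI allI exI)
    show "vscale L c w i \<in> carrier (W i)" for i using w by (simp add: simps W.closed)
    show "\<theta> i (vscale L c w (Suc i)) = vscale L c w i" for i
      using w by (simp add: simps vlinear_scale[OF map_vlinear] limit_map)
    show "vnorm (W i) (vscale L c w i) \<le> \<bar>c\<bar> * vnorm L w" for i
      using w mult_left_mono[OF stage_norm_le[OF w, of i], of "\<bar>c\<bar>"] by (simp add: simps W.norm_scale)
  qed
  note closed = \<open>\<And>v w. \<lbrakk>v \<in> carrier L; w \<in> carrier L\<rbrakk> \<Longrightarrow> vadd L v w \<in> carrier L\<close>
    \<open>\<And>c w. w \<in> carrier L \<Longrightarrow> vscale L c w \<in> carrier L\<close>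
  show "vadd L (vadd L u v) w = vadd L u (vadd L v w)"
    if "u \<in> carrier L" "v \<in> carrier L" "w \<in> carrier L" for u v w
    using that by (simp add: simps W.add_assoc)
  show "vadd L v w = vadd L w v" if "v \<in> carrier L" "w \<in> carrier L" for v w
    unfolding limit_vadd using W.add_commute[OF limit_stage[OF that(1)] limit_stage[OF that(2)]] by blast
  show "vadd L (vzero L) w = w" if "w \<in> carrier L" for w
    using that by (simp add: simps W.add_zero)
  show "\<exists>v\<in>carrier L. vadd L w v = vzero L" if "w \<in> carrier L" for w
    using that by (intro bexI[OF _ closed(2)[OF that, of "-1"]]) (simp add: simps W.add_negative)
  show "vscale L c (vadd L v w) = vadd L (vscale L c v) (vscale L c w)"
    if "v \<in> carrier L" "w \<in> carrier L" for c v w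
    using that by (simp add: simps W.scale_add_right)
  show "vscale L (c + d) w = vadd L (vscale L c w) (vscale L d w)" if "w \<in> carrier L" for c d w
    using that by (simp add: simps W.scale_add_left)
  show "vscale L c (vscale L d w) = vscale L (c * d) w" if "w \<in> carrier L" for c d w
    using that by (simp add: simps W.scale_scale)
  show "vscale L 1 w = w" if "w \<in> carrier L" for w
    using that by (simp add: simps W.scale_one)
  show nonneg: "0 \<le> vnorm L w" if "w \<in> carrier L" for w
    using stage_norm_le[OF that, of 0] W.norm_nonneg[OF limit_stage[OF that], of 0] by linarith
  show "vnorm L w = 0 \<longleftrightarrow> w = vzero L" if w: "w \<in> carrier L" for w
  proof
    assume "vnorm L w = 0"
    then have "vnorm (W i) (w i) = 0" for i
      using stage_norm_le[OF w, of i] W.norm_nonneg[OF limit_stage[OF w], of i] by simp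
    then show "w = vzero L"
      using W.norm_eq_zero[OF limit_stage[OF w]] by (auto simp: limit_vzero)
  next
    assume "w = vzero L"
    then show "vnorm L w = 0" by (simp add: inverse_limit_def W.norm_zero)
  qed
  show "vnorm L (vadd L v w) \<le> vnorm L v + vnorm L w"
    if vw: "v \<in> carrier L" "w \<in> carrier L" for v w
  proof (rule LIMSEQ_le)
    show "(\<lambda>i. vnorm (W i) (vadd L v w i)) \<longlonglongrightarrow> vnorm L (vadd L v w)"
      by (intro limit_norm_tendsto closed vw)
    show "(\<lambda>i. vnorm (W i) (v i) + vnorm (W i) (w i)) \<longlonglongrightarrow> vnorm L v + vnorm L w"
      by (intro tendsto_add limit_norm_tendsto vw)
  qed (use vw in \<open>auto simp: simps intro!: W.norm_triangle\<close>)
  show "vnorm L (vscale L c w) = \<bar>c\<bar> * vnorm L w" if w: "w \<in> carrier L" for c w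
  proof (rule LIMSEQ_unique)
    show "(\<lambda>i. vnorm (W i) (vscale L c w i)) \<longlonglongrightarrow> vnorm L (vscale L c w)"
      by (intro limit_norm_tendsto closed w)
    show "(\<lambda>i. vnorm (W i) (vscale L c w i)) \<longlonglongrightarrow> \<bar>c\<bar> * vnorm L w"
      using tendsto_mult_left[OF limit_norm_tendsto[OF w], of "\<bar>c\<bar>"] w
      by (simp add: simps W.norm_scale)
  qed
qed

text \<open>
  The stagewise limits are compatible because the maps of the system, being contractive, commute
  with limits, and the bound on the norms is inherited at every stage.
\<close>

lemma stagewise_limit:
  assumes v: "\<And>k. v k \<in> carrier L" and bounded: "\<And>k. vnorm L (v k) \<le> M"
    and conv: "\<And>j. strongly_convergent (W j) (\<lambda>k. v k j)"
  obtains w where "w \<in> carrier L" "\<And>j. (\<lambda>k. vnorm (W j) (vminus (W j) (v k j) (w j))) \<longlonglongrightarrow> 0"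
proof -
  interpret W: normed_space "W i" for i by (rule stage)
  have "\<exists>l\<in>carrier (W j). (\<lambda>k. vnorm (W j) (vminus (W j) (v k j) l)) \<longlonglongrightarrow> 0" for j
    using conv[of j] W.strongly_convergent_iff[of "\<lambda>k. v k j"] limit_stage[OF v] by blast
  then obtain w where w: "\<And>j. w j \<in> carrier (W j)"
      "\<And>j. (\<lambda>k. vnorm (W j) (vminus (W j) (v k j) (w j))) \<longlonglongrightarrow> 0"
    by metis
  have "w \<in> carrier L"
    unfolding limit_carrier_iff
  proof (intro conjI allI exI)
    show "\<theta> i (w (Suc i)) = w i" for i
    proof -
      note \<theta>w = vlinear_closed[OF map_vlinear w(1), of i]
      have "vnorm (W i) (vminus (W i) (\<theta> i (w (Suc i))) (w i)) \<le>
          vnorm (W (Suc i)) (vminus (W (Suc i)) (v k (Suc i)) (w (Suc i))) +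
          vnorm (W i) (vminus (W i) (v k i) (w i))" for k
      proof -
        note vk = limit_stage[OF v]
        have "vnorm (W i) (vminus (W i) (v k i) (\<theta> i (w (Suc i)))) \<le>
            vnorm (W (Suc i)) (vminus (W (Suc i)) (v k (Suc i)) (w (Suc i)))"
          using map_contractive[OF W.minus_closed[OF vk w(1)], of i k]
            vlinear_minus[OF stage_seminormed map_vlinear vk w(1), of i k]
          by (simp add: limit_map[OF v])
        then show ?thesis
          using W.norm_minus_triangle[OF \<theta>w vk w(1), of k] W.norm_minus_commute[OF \<theta>w vk, of k]
          by simp
      qed
      then have "vnorm (W i) (vminus (W i) (\<theta> i (w (Suc i))) (w i)) \<le> 0"
        using tendsto_add[OF w(2)[of "Suc i"] w(2)[of i]] by (intro LIMSEQ_le_const) auto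
      then show ?thesis
        using W.norm_nonneg[OF W.minus_closed[OF \<theta>w w(1)]] W.norm_minus_eq_zero[OF \<theta>w w(1)]
        by simp
    qed
    show "vnorm (W i) (w i) \<le> M" for i
      by (rule LIMSEQ_le_const2[OF W.norm_tendsto[OF limit_stage[OF v] w]])
        (use stage_norm_le[OF v] bounded order_trans in blast)
  qed (rule w(1))
  then show ?thesis using that w(2) by blast
qed

end


section \<open>The inverse limit as a dual space\<close>

context inverse_system
begin

lemma direct_system_dual: "direct_system (dual_spaces W) (dual_maps W \<theta>)"
proof (rule direct_system.intro)
  show "seminormed_space (dual_space (W i))" for i
    by (rule normed_space_imp_seminormed[OF seminormed_space.normed_space_dual[OF stage_seminormed]])
  note closed = dual_map_closed[OF stage_seminormed stage_seminormed map_vlinear map_contractive]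
  show "vlinear (dual_space (W i)) (dual_space (W (Suc i))) (dual_map (W (Suc i)) (\<theta> i))" for i
    using closed vlinear_closed[OF map_vlinear]
    by (auto simp: vlinear_def dual_vadd dual_vscale dual_map_def fun_eq_iff)
  show "vnorm (dual_space (W (Suc i))) (dual_map (W (Suc i)) (\<theta> i) \<phi>) \<le> vnorm (dual_space (W i)) \<phi>"
    if "\<phi> \<in> carrier (dual_space (W i))" for i \<phi>
    by (rule dual_map_contractive[OF stage_seminormed stage_seminormed map_vlinear map_contractive that])
qed

sublocale dual: direct_system "dual_spaces W" "dual_maps W \<theta>"
  by (rule direct_system_dual)

abbreviation "Y \<equiv> predual W \<theta>"
abbreviation "\<tau> \<equiv> canonical_map (dual_spaces W) (dual_maps W \<theta>)"

lemma normed_space_predual: "normed_space Y"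
  unfolding predual_def by (rule dual.normed_space_direct_limit)

lemma \<tau>_vlinear: "vlinear (dual_space (W j)) Y (\<tau> j)"
  unfolding predual_def by (rule dual.canonical_map_vlinear)

lemmas \<tau>_closed = vlinear_closed[OF \<tau>_vlinear]

lemma \<tau>_norm_le:
  assumes "\<phi> \<in> carrier (dual_space (W j))"
  shows "vnorm Y (\<tau> j \<phi>) \<le> vnorm (dual_space (W j)) \<phi>"
proof (rule LIMSEQ_le_const2)
  show "(\<lambda>n. vnorm (dual_space (W n)) (bond (dual_maps W \<theta>) j n \<phi>)) \<longlonglongrightarrow> vnorm Y (\<tau> j \<phi>)"
    unfolding predual_def by (rule dual.canonical_map_norm_tendsto[OF assms])
  have "vnorm (dual_space (W n)) (bond (dual_maps W \<theta>) j n \<phi>) \<le> vnorm (dual_space (W j)) \<phi>"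
    if "j \<le> n" for n
    using that
  proof (induction n rule: dec_induct)
    case (step n)
    then show ?case
      using dual.map_contractive[OF dual.bond_closed[OF step.hyps(1) assms]]
      by (simp add: dual.bond_Suc)
  qed (simp add: dual.bond_self)
  then show "\<exists>N. \<forall>n\<ge>N. vnorm (dual_space (W n)) (bond (dual_maps W \<theta>) j n \<phi>)
      \<le> vnorm (dual_space (W j)) \<phi>" by blast
qed

lemma bond_dual_apply:
  assumes x: "x \<in> carrier L" and "j \<le> n"
  shows "bond (dual_maps W \<theta>) j n \<phi> (x n) = \<phi> (x j)"
  using assms(2)
proof (induction n rule: dec_induct)
  case (step n)
  have "bond (dual_maps W \<theta>) j (Suc n) \<phi> (x (Suc n)) =
      dual_map (W (Suc n)) (\<theta> n) (bond (dual_maps W \<theta>) j n \<phi>) (x (Suc n))"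
    by (simp only: dual.bond_Suc[OF step.hyps(1)])
  also have "\<dots> = bond (dual_maps W \<theta>) j n \<phi> (x n)"
    by (subst dual_map_def) (simp only: restrict_apply' limit_stage[OF x] limit_map[OF x])
  finally show ?case using step.IH by (rule trans)
qed (simp add: dual.bond_self)

text \<open>
  The pairing of \<open>x\<close> with \<open>\<phi>\<close> may be computed at any later stage \<open>n\<close>, where it is at most
  \<open>\<parallel>x\<parallel>\<close> times the norm of the image of \<open>\<phi>\<close>; those norms tend to the norm in the direct limit.
\<close>

lemma pairing_bound:
  assumes x: "x \<in> carrier L" and \<phi>: "\<phi> \<in> carrier (dual_space (W j))"
  shows "\<bar>\<phi> (x j)\<bar> \<le> vnorm L x * vnorm Y (\<tau> j \<phi>)"
proof (rule LIMSEQ_le_const)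
  let ?b = "\<lambda>n. bond (dual_maps W \<theta>) j n \<phi>"
  show "(\<lambda>n. vnorm L x * vnorm (dual_space (W n)) (?b n)) \<longlonglongrightarrow> vnorm L x * vnorm Y (\<tau> j \<phi>)"
    unfolding predual_def by (intro tendsto_mult_left dual.canonical_map_norm_tendsto \<phi>)
  have "\<bar>\<phi> (x j)\<bar> \<le> vnorm L x * vnorm (dual_space (W n)) (?b n)" if n: "j \<le> n" for n
  proof -
    interpret Wn: normed_space "W n" by (rule stage)
    note b = dual.bond_closed[OF n \<phi>]
    have "\<bar>\<phi> (x j)\<bar> \<le> vnorm (dual_space (W n)) (?b n) * vnorm (W n) (x n)"
      using Wn.dual_le_norm[OF b limit_stage[OF x]] by (simp add: bond_dual_apply[OF x n])
    also have "\<dots> \<le> vnorm (dual_space (W n)) (?b n) * vnorm L x"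
      by (intro mult_left_mono stage_norm_le x Wn.dual_norm_nonneg b)
    finally show ?thesis by (simp add: mult.commute)
  qed
  then show "\<exists>N. \<forall>n\<ge>N. \<bar>\<phi> (x j)\<bar> \<le> vnorm L x * vnorm (dual_space (W n)) (?b n)" by blast
qed

text \<open>
  The values prescribed on the images of the \<open>\<tau> j\<close> form a linear relation: vectors of different
  stages meet at a common later one. By \<open>pairing_bound\<close> it is bounded, hence extends to \<open>Y\<close>.
\<close>

lemma dual_iso_exists:
  assumes x: "x \<in> carrier L"
  obtains f where "f \<in> carrier (dual_space Y)" "vnorm (dual_space Y) f \<le> vnorm L x"
    "\<And>j \<phi>. \<phi> \<in> carrier (dual_space (W j)) \<Longrightarrow> f (\<tau> j \<phi>) = \<phi> (x j)"
proof -
  interpret Y: normed_space Y by (rule normed_space_predual)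
  interpret L: normed_space L by (rule normed_space_inverse_limit)
  define G where "G = {(\<tau> j \<phi>, \<phi> (x j)) | j \<phi>. \<phi> \<in> carrier (dual_space (W j))}"
  have GI: "(\<tau> j \<phi>, \<phi> (x j)) \<in> G" if "\<phi> \<in> carrier (dual_space (W j))" for j \<phi>
    using that unfolding G_def by blast
  interpret W: normed_space "W i" for i by (rule stage)
  have G: "bounded_linear_relation Y (vnorm L x) G"
    unfolding bounded_linear_relation_def
  proof (intro conjI)
    have scale: "(vscale Y c y, c * r) \<in> G" if yr: "(y, r) \<in> G" for c y r
    proof -
      obtain j \<phi> where j: "\<phi> \<in> carrier (dual_space (W j))" "y = \<tau> j \<phi>" "r = \<phi> (x j)"
        using yr unfolding G_def by blast
      have "vscale (dual_space (W j)) c \<phi> (x j) = c * \<phi> (x j)"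
        using limit_stage[OF x] by (simp add: dual_vscale)
      then show ?thesis
        using GI[OF W.dual_scale_closed[OF j(1), of c]]
        by (simp only: vlinear_scale[OF \<tau>_vlinear j(1)] j(2,3))
    qed
    then show "\<forall>c. \<forall>(y, r)\<in>G. (vscale Y c y, c * r) \<in> G" by blast
    show "(vzero Y, 0) \<in> G"
      using scale[OF GI[OF W.dual_zero_closed], of 0 0] Y.scale_zero_left[OF \<tau>_closed[OF W.dual_zero_closed]]
      by simp
    \<comment> \<open>Two vectors coming from different stages are added at the later one.\<close>
    have "(vadd Y y z, r + s) \<in> G" if yr: "(y, r) \<in> G" and zs: "(z, s) \<in> G" for y r z s
    proof -
      obtain i \<phi> where i: "\<phi> \<in> carrier (dual_space (W i))" "y = \<tau> i \<phi>" "r = \<phi> (x i)"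
        using yr unfolding G_def by blast
      obtain j \<psi> where j: "\<psi> \<in> carrier (dual_space (W j))" "z = \<tau> j \<psi>" "s = \<psi> (x j)"
        using zs unfolding G_def by blast
      let ?n = "max i j" and ?b = "bond (dual_maps W \<theta>)"
      have b: "?b i ?n \<phi> \<in> carrier (dual_space (W ?n))" "?b j ?n \<psi> \<in> carrier (dual_space (W ?n))"
        using dual.bond_closed i j by auto
      have "\<tau> ?n (?b i ?n \<phi>) = y" "\<tau> ?n (?b j ?n \<psi>) = z"
        using i j dual.canonical_map_bond by auto
      moreover have "?b i ?n \<phi> (x ?n) = r" "?b j ?n \<psi> (x ?n) = s"
        using i j bond_dual_apply[OF x] by auto
      moreover have "vadd (dual_space (W ?n)) (?b i ?n \<phi>) (?b j ?n \<psi>) (x ?n) =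
          ?b i ?n \<phi> (x ?n) + ?b j ?n \<psi> (x ?n)"
        using limit_stage[OF x] by (simp add: dual_vadd)
      ultimately show ?thesis
        using GI[OF W.dual_add_closed[OF b]] by (simp only: vlinear_add[OF \<tau>_vlinear b])
    qed
    then show "\<forall>(y, r)\<in>G. \<forall>(z, s)\<in>G. (vadd Y y z, r + s) \<in> G" by blast
    show "\<forall>(y, r)\<in>G. y \<in> carrier Y \<and> \<bar>r\<bar> \<le> vnorm L x * vnorm Y y"
      using \<tau>_closed pairing_bound[OF x] unfolding G_def by auto
  qed
  show ?thesis
  proof (rule Y.hahn_banach[OF G L.norm_nonneg[OF x]])
    fix f assume f: "f \<in> carrier (dual_space Y)" "\<And>y r. (y, r) \<in> G \<Longrightarrow> f y = r"
      "\<And>y. y \<in> carrier Y \<Longrightarrow> \<bar>f y\<bar> \<le> vnorm L x * vnorm Y y"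
    show ?thesis
      by (rule that[OF f(1) Y.dual_norm_le[OF L.norm_nonneg[OF x] f(3)] f(2)[OF GI]])
  qed
qed

lemma predual_functional_eqI:
  assumes f: "f \<in> carrier (dual_space Y)" and g: "g \<in> carrier (dual_space Y)"
    and eq: "\<And>j \<phi>. \<phi> \<in> carrier (dual_space (W j)) \<Longrightarrow> f (\<tau> j \<phi>) = g (\<tau> j \<phi>)"
  shows "f = g"
proof -
  interpret Y: normed_space Y by (rule normed_space_predual)
  let ?K = "vnorm (dual_space Y) f + vnorm (dual_space Y) g"
  have "f y = g y" if y: "y \<in> carrier Y" for y
  proof (rule ccontr)
    assume "f y \<noteq> g y"
    then have pos: "0 < \<bar>f y - g y\<bar> / (?K + 1)"
      using Y.dual_norm_nonneg[OF f] Y.dual_norm_nonneg[OF g] by simp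
    obtain j \<phi> where j: "\<phi> \<in> carrier (dual_space (W j))"
      "vnorm Y (vminus Y y (\<tau> j \<phi>)) < \<bar>f y - g y\<bar> / (?K + 1)"
      using dual.canonical_maps_dense[OF y[unfolded predual_def] pos] unfolding predual_def by blast
    define d where "d = vminus Y y (\<tau> j \<phi>)"
    have d: "d \<in> carrier Y" using y \<tau>_closed[OF j(1)] by (simp add: d_def Y.minus_closed)
    have "f y - g y = f d - g d"
      using eq[OF j(1)] y \<tau>_closed[OF j(1)] by (simp add: d_def Y.dual_minus f g)
    then have "\<bar>f y - g y\<bar> \<le> ?K * vnorm Y d"
      using Y.dual_le_norm[OF f d] Y.dual_le_norm[OF g d] by (simp add: distrib_right)
    also have "\<dots> \<le> (?K + 1) * vnorm Y d"
      using Y.norm_nonneg[OF d] by (intro mult_right_mono) auto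
    also have "\<dots> < \<bar>f y - g y\<bar>"
      using j(2) Y.dual_norm_nonneg[OF f] Y.dual_norm_nonneg[OF g]
      by (simp add: d_def pos_less_divide_eq mult.commute)
    finally show False by simp
  qed
  then show ?thesis by (rule Y.dual_eqI[OF f g])
qed

abbreviation "C \<equiv> dual_iso W \<theta>"

lemma
  assumes x: "x \<in> carrier L"
  shows dual_iso_closed: "C x \<in> carrier (dual_space Y)"
    and dual_iso_apply: "\<phi> \<in> carrier (dual_space (W j)) \<Longrightarrow> C x (\<tau> j \<phi>) = \<phi> (x j)"
    and dual_iso_norm: "vnorm (dual_space Y) (C x) = vnorm L x"
proof -
  interpret Y: normed_space Y by (rule normed_space_predual)
  let ?P = "\<lambda>f. f \<in> carrier (dual_space Y) \<and>
    (\<forall>j. \<forall>\<phi>\<in>carrier (dual_space (W j)). f (\<tau> j \<phi>) = \<phi> (x j))"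
  obtain f where f: "f \<in> carrier (dual_space Y)" "vnorm (dual_space Y) f \<le> vnorm L x"
    "\<And>j \<phi>. \<phi> \<in> carrier (dual_space (W j)) \<Longrightarrow> f (\<tau> j \<phi>) = \<phi> (x j)"
    using dual_iso_exists[OF x] by blast
  have C: "C x = f"
    unfolding dual_iso_def
  proof (rule the_equality)
    show "?P f" using f by blast
    show "g = f" if "?P g" for g
      using that f by (intro predual_functional_eqI) auto
  qed
  show closed: "C x \<in> carrier (dual_space Y)" using f C by simp
  show app: "C x (\<tau> j \<phi>) = \<phi> (x j)" if "\<phi> \<in> carrier (dual_space (W j))" for j \<phi>
    using f C that by simp
  have "vnorm (W j) (x j) \<le> vnorm (dual_space Y) (C x)" for j
  proof -
    interpret Wj: normed_space "W j" by (rule stage)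
    obtain \<phi> where \<phi>: "\<phi> \<in> carrier (dual_space (W j))" "\<phi> (x j) = vnorm (W j) (x j)"
      "vnorm (dual_space (W j)) \<phi> \<le> 1"
      using Wj.norming_functional[OF limit_stage[OF x]] by blast
    have "vnorm (W j) (x j) \<le> vnorm (dual_space Y) (C x) * vnorm Y (\<tau> j \<phi>)"
      using Y.dual_le_norm[OF closed \<tau>_closed[OF \<phi>(1)]] app[OF \<phi>(1)] \<phi>(2) by simp
    also have "\<dots> \<le> vnorm (dual_space Y) (C x) * 1"
      using \<tau>_norm_le[OF \<phi>(1)] \<phi>(3) Y.dual_norm_nonneg[OF closed] by (intro mult_left_mono) auto
    finally show ?thesis by simp
  qed
  then have "vnorm L x \<le> vnorm (dual_space Y) (C x)"
    by (intro LIMSEQ_le_const2[OF limit_norm_tendsto[OF x]]) auto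
  then show "vnorm (dual_space Y) (C x) = vnorm L x" using f(2) C by simp
qed

lemma dual_iso_minus:
  assumes x: "x \<in> carrier L" and y: "y \<in> carrier L"
  shows "C (vminus L x y) = vminus (dual_space Y) (C x) (C y)"
proof (rule predual_functional_eqI)
  interpret L: normed_space L by (rule normed_space_inverse_limit)
  interpret Y: normed_space Y by (rule normed_space_predual)
  interpret D: normed_space "dual_space Y" by (rule Y.normed_space_dual)
  show "C (vminus L x y) \<in> carrier (dual_space Y)"
    by (intro dual_iso_closed L.minus_closed x y)
  show "vminus (dual_space Y) (C x) (C y) \<in> carrier (dual_space Y)"
    by (intro D.minus_closed dual_iso_closed x y)
  fix j \<phi> assume \<phi>: "\<phi> \<in> carrier (dual_space (W j))"
  interpret Wj: normed_space "W j" by (rule stage)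
  have "C (vminus L x y) (\<tau> j \<phi>) = \<phi> (x j) - \<phi> (y j)"
    using dual_iso_apply[OF L.minus_closed[OF x y] \<phi>]
      Wj.dual_minus[OF \<phi> limit_stage[OF x] limit_stage[OF y]] by (simp add: limit_vminus)
  then show "C (vminus L x y) (\<tau> j \<phi>) = vminus (dual_space Y) (C x) (C y) (\<tau> j \<phi>)"
    using \<phi> x y \<tau>_closed[OF \<phi>]
    by (simp add: vminus_def dual_vadd dual_vscale dual_iso_apply)
qed

text \<open>
  Restricting a functional \<open>f\<close> along \<open>\<tau> j\<close> gives an element of the bidual of \<open>W j\<close>, which
  is evaluation at a vector because \<open>W j\<close> is reflexive. Functionals separate the points of
  each stage, so that these vectors are compatible.
\<close>

lemma dual_iso_surj:
  assumes f: "f \<in> carrier (dual_space Y)"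
  obtains x where "x \<in> carrier L" "C x = f"
proof -
  interpret Y: normed_space Y by (rule normed_space_predual)
  interpret W: normed_space "W i" for i by (rule stage)
  have "\<exists>x\<in>carrier (W j). \<forall>\<phi>\<in>carrier (dual_space (W j)). f (\<tau> j \<phi>) = \<phi> x" for j
  proof -
    have "vlinear Y real_line f" using f by (simp add: dual_space_def)
    then have F: "vlinear (dual_space (W j)) real_line (\<lambda>\<phi>. f (\<tau> j \<phi>))"
      by (rule vlinear_comp[OF \<tau>_vlinear])
    show ?thesis
      by (rule W.finite_dimensional_reflexive[OF stage_finite_dimensional F]) auto
  qed
  then obtain x where x: "\<And>j. x j \<in> carrier (W j)"
    "\<And>j \<phi>. \<phi> \<in> carrier (dual_space (W j)) \<Longrightarrow> f (\<tau> j \<phi>) = \<phi> (x j)"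
    by metis
  have "x \<in> carrier L"
    unfolding limit_carrier_iff
  proof (intro conjI allI exI)
    show "\<theta> i (x (Suc i)) = x i" for i
    proof (rule W.dual_separates[OF vlinear_closed[OF map_vlinear x(1)] x(1)])
      fix \<phi> assume \<phi>: "\<phi> \<in> carrier (dual_space (W i))"
      have "bond (dual_maps W \<theta>) i (Suc i) \<phi> = dual_map (W (Suc i)) (\<theta> i) \<phi>"
        by (simp add: dual.bond_Suc dual.bond_self)
      then have "\<tau> (Suc i) (dual_map (W (Suc i)) (\<theta> i) \<phi>) = \<tau> i \<phi>"
        using dual.canonical_map_bond[OF \<phi>, of "Suc i"] by simp
      then show "\<phi> (\<theta> i (x (Suc i))) = \<phi> (x i)"
        using x(2)[OF vlinear_closed[OF dual.map_vlinear \<phi>]] x(2)[OF \<phi>] x(1)[of "Suc i"]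
        by (simp add: dual_map_def)
    qed
    show "vnorm (W i) (x i) \<le> vnorm (dual_space Y) f" for i
    proof -
      obtain \<phi> where \<phi>: "\<phi> \<in> carrier (dual_space (W i))" "\<phi> (x i) = vnorm (W i) (x i)"
        "vnorm (dual_space (W i)) \<phi> \<le> 1"
        using W.norming_functional[OF x(1)] by blast
      have "vnorm (W i) (x i) \<le> vnorm (dual_space Y) f * vnorm Y (\<tau> i \<phi>)"
        using Y.dual_le_norm[OF f \<tau>_closed[OF \<phi>(1)]] x(2)[OF \<phi>(1)] \<phi>(2) by simp
      also have "\<dots> \<le> vnorm (dual_space Y) f * 1"
        using \<tau>_norm_le[OF \<phi>(1)] \<phi>(3) Y.dual_norm_nonneg[OF f] by (intro mult_left_mono) auto
      finally show ?thesis by simp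
    qed
  qed (rule x(1))
  then show ?thesis
    using that[of x] predual_functional_eqI[OF dual_iso_closed f] dual_iso_apply x(2) by simp
qed

lemma strongly_convergent_dual_iso:
  assumes v: "\<And>k. v k \<in> carrier L"
  shows "strongly_convergent (dual_space Y) (\<lambda>k. C (v k)) \<longleftrightarrow> strongly_convergent L v"
proof -
  interpret L: normed_space L by (rule normed_space_inverse_limit)
  interpret Y: normed_space Y by (rule normed_space_predual)
  interpret D: normed_space "dual_space Y" by (rule Y.normed_space_dual)
  have isometry: "vnorm (dual_space Y) (vminus (dual_space Y) (C (v k)) (C x)) =
      vnorm L (vminus L (v k) x)" if "x \<in> carrier L" for k x
    using dual_iso_minus[OF v that] dual_iso_norm[OF L.minus_closed[OF v that]] by simp
  have "strongly_convergent (dual_space Y) (\<lambda>k. C (v k)) \<longleftrightarrow>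
      (\<exists>f\<in>carrier (dual_space Y).
        (\<lambda>k. vnorm (dual_space Y) (vminus (dual_space Y) (C (v k)) f)) \<longlonglongrightarrow> 0)"
    using dual_iso_closed[OF v] by (rule D.strongly_convergent_iff)
  also have "\<dots> \<longleftrightarrow> (\<exists>x\<in>carrier L.
      (\<lambda>k. vnorm (dual_space Y) (vminus (dual_space Y) (C (v k)) (C x))) \<longlonglongrightarrow> 0)"
  proof
    assume "\<exists>f\<in>carrier (dual_space Y).
        (\<lambda>k. vnorm (dual_space Y) (vminus (dual_space Y) (C (v k)) f)) \<longlonglongrightarrow> 0"
    then obtain f where f: "f \<in> carrier (dual_space Y)"
      "(\<lambda>k. vnorm (dual_space Y) (vminus (dual_space Y) (C (v k)) f)) \<longlonglongrightarrow> 0"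
      by blast
    obtain x where "x \<in> carrier L" "C x = f" by (rule dual_iso_surj[OF f(1)])
    then show "\<exists>x\<in>carrier L.
        (\<lambda>k. vnorm (dual_space Y) (vminus (dual_space Y) (C (v k)) (C x))) \<longlonglongrightarrow> 0"
      using f(2) by blast
  qed (use dual_iso_closed in blast)
  also have "\<dots> \<longleftrightarrow> strongly_convergent L v"
    using isometry by (simp add: L.strongly_convergent_iff[OF v])
  finally show ?thesis .
qed

text \<open>
  Weak* convergence of a bounded sequence need only be tested on the dense union of the images of
  the \<open>\<tau> j\<close>, where it is weak convergence at each stage.
\<close>

lemma weak_star_limitI:
  assumes v: "\<And>k. v k \<in> carrier L" and w: "w \<in> carrier L" and M: "\<And>k. vnorm L (v k) \<le> M"
    and conv: "\<And>j. (\<lambda>k. vnorm (W j) (vminus (W j) (v k j) (w j))) \<longlonglongrightarrow> 0"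
  shows "weak_star_limit Y (\<lambda>k. C (v k)) (C w)"
  unfolding weak_star_limit_def
proof (intro conjI ballI dual_iso_closed[OF w])
  interpret Y: normed_space Y by (rule normed_space_predual)
  interpret W: normed_space "W i" for i by (rule stage)
  interpret L: normed_space L by (rule normed_space_inverse_limit)
  fix y assume y: "y \<in> carrier Y"
  show "(\<lambda>k. C (v k) y) \<longlonglongrightarrow> C w y"
    unfolding tendsto_iff eventually_sequentially
  proof (intro allI impI)
    fix \<epsilon> :: real assume \<epsilon>: "0 < \<epsilon>"
    define K where "K = M + vnorm L w + 1"
    have K: "0 < K" using L.norm_nonneg[OF v[of 0]] M[of 0] L.norm_nonneg[OF w] by (simp add: K_def)
    then have pos: "0 < \<epsilon> / (2 * K)" using \<epsilon> by simp
    obtain j \<phi> where j: "\<phi> \<in> carrier (dual_space (W j))"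
      "vnorm Y (vminus Y y (\<tau> j \<phi>)) < \<epsilon> / (2 * K)"
      using dual.canonical_maps_dense[OF y[unfolded predual_def] pos] unfolding predual_def by blast
    define d where "d = vminus Y y (\<tau> j \<phi>)"
    note t = \<tau>_closed[OF j(1)]
    have d: "d \<in> carrier Y" using y t by (simp add: d_def Y.minus_closed)
    have "(\<lambda>k. \<phi> (v k j)) \<longlonglongrightarrow> \<phi> (w j)"
      by (rule W.dual_tendsto[OF j(1) limit_stage[OF v] limit_stage[OF w] conv])
    then obtain N where N: "\<And>k. k \<ge> N \<Longrightarrow> dist (\<phi> (v k j)) (\<phi> (w j)) < \<epsilon> / 2"
      using \<epsilon> unfolding tendsto_iff eventually_sequentially by (meson half_gt_zero)
    have "dist (C (v k) y) (C w y) < \<epsilon>" if "k \<ge> N" for k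
    proof -
      have split: "C x y = \<phi> (x j) + C x d" if x: "x \<in> carrier L" for x
        using Y.dual_minus[OF dual_iso_closed[OF x] y t] dual_iso_apply[OF x j(1)] by (simp add: d_def)
      have "\<bar>C (v k) d\<bar> \<le> vnorm L (v k) * vnorm Y d"
        using Y.dual_le_norm[OF dual_iso_closed[OF v] d] by (simp add: dual_iso_norm v)
      moreover have "\<dots> \<le> M * vnorm Y d"
        using M Y.norm_nonneg[OF d] by (rule mult_right_mono)
      moreover have "\<bar>C w d\<bar> \<le> vnorm L w * vnorm Y d"
        using Y.dual_le_norm[OF dual_iso_closed[OF w] d] by (simp add: dual_iso_norm w)
      moreover have "K * vnorm Y d < \<epsilon> / 2"
        using j(2) K by (simp add: d_def field_simps)
      ultimately show ?thesis
        using N[OF \<open>k \<ge> N\<close>] Y.norm_nonneg[OF d]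
        unfolding split[OF v] split[OF w] dist_real_def K_def distrib_right by linarith
    qed
    then show "\<exists>N. \<forall>k\<ge>N. dist (C (v k) y) (C w y) < \<epsilon>" by blast
  qed
qed

lemma weak_star_limitD:
  assumes v: "\<And>k. v k \<in> carrier L" and w: "w \<in> carrier L"
    and weak: "weak_star_limit Y (\<lambda>k. C (v k)) (C w)"
  shows "(\<lambda>k. vnorm (W j) (vminus (W j) (v k j) (w j))) \<longlonglongrightarrow> 0"
proof -
  interpret Wj: normed_space "W j" by (rule stage)
  have lim: "(\<lambda>k. \<phi> (v k j)) \<longlonglongrightarrow> \<phi> (w j)" if \<phi>: "\<phi> \<in> carrier (dual_space (W j))" for \<phi>
    using weak \<tau>_closed[OF \<phi>] dual_iso_apply[OF v \<phi>] dual_iso_apply[OF w \<phi>]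
    unfolding weak_star_limit_def by fastforce
  obtain l where l: "l \<in> carrier (W j)" "(\<lambda>k. vnorm (W j) (vminus (W j) (v k j) l)) \<longlonglongrightarrow> 0"
    using Wj.finite_dimensional_weak_convergence[OF stage_finite_dimensional, of "\<lambda>k. v k j"]
      limit_stage[OF v] lim convergentI by meson
  have "l = w j"
  proof (rule Wj.dual_separates[OF l(1) limit_stage[OF w]])
    fix \<phi> assume \<phi>: "\<phi> \<in> carrier (dual_space (W j))"
    show "\<phi> l = \<phi> (w j)"
      using Wj.dual_tendsto[OF \<phi> limit_stage[OF v] l] lim[OF \<phi>] by (rule LIMSEQ_unique)
  qed
  then show ?thesis using l(2) by simp
qed

end


section \<open>The Determining Property and the Asymptotic Norming Property\<close>

text \<open>
  A Dini-type argument: at an index where \<open>b\<close> is close to \<open>B\<close>, almost all of the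
  sequences \<open>a k\<close> are close to their limits, and they stay so by monotonicity. The finitely many
  others pose no problem.
\<close>

lemma uniform_limit_of_monotone:
  fixes a :: "nat \<Rightarrow> nat \<Rightarrow> real"
  assumes mono: "\<And>k. incseq (a k)" and a: "\<And>k. a k \<longlonglongrightarrow> A k"
    and col: "\<And>j. (\<lambda>k. a k j) \<longlonglongrightarrow> b j" and b: "b \<longlonglongrightarrow> B" and A: "A \<longlonglongrightarrow> B"
  shows "uniform_limit UNIV (\<lambda>j k. a k j) A sequentially"
proof (rule uniform_limitI)
  fix \<epsilon> :: real assume "0 < \<epsilon>"
  then have e: "0 < \<epsilon> / 3" by simp
  obtain j where j: "dist (b j) B < \<epsilon> / 3"
    using tendstoD[OF b e] by (auto simp: eventually_sequentially)
  obtain N where N: "\<And>k. k \<ge> N \<Longrightarrow> dist (a k j) (b j) < \<epsilon> / 3 \<and> dist (A k) B < \<epsilon> / 3"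
    using eventually_conj[OF tendstoD[OF col e] tendstoD[OF A e]]
    by (auto simp: eventually_sequentially)
  have "\<forall>\<^sub>F i in sequentially. \<forall>k\<in>{..<N}. dist (a k i) (A k) < \<epsilon>"
    using tendstoD[OF a \<open>0 < \<epsilon>\<close>] by (intro eventually_ball_finite) auto
  moreover have "\<forall>\<^sub>F i in sequentially. j \<le> i" by (rule eventually_ge_at_top)
  ultimately show "\<forall>\<^sub>F i in sequentially. \<forall>k\<in>UNIV. dist (a k i) (A k) < \<epsilon>"
  proof eventually_elim
    case (elim i)
    have "dist (a k i) (A k) < \<epsilon>" for k
    proof (cases "k < N")
      case False
      have "a k j \<le> a k i" "a k i \<le> A k"
        using mono[of k] elim(2) incseq_le[OF mono a] by (auto simp: incseq_def)
      then show ?thesis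
        using N[of k] j False unfolding dist_real_def by linarith
    qed (use elim in simp)
    then show ?case by blast
  qed
qed

context inverse_system
begin

theorem asymptotic_norming_iff_determining:
  assumes V: "V \<subseteq> carrier L"
  shows "asymptotic_norming_property Y (C ` V) \<longleftrightarrow> determining_property W \<theta> V"
proof
  interpret W: normed_space "W i" for i by (rule stage)
  assume anp: "asymptotic_norming_property Y (C ` V)"
  show "determining_property W \<theta> V"
    unfolding determining_property_def
  proof (intro allI impI, elim conjE)
    fix v assume "range v \<subseteq> V" and conv: "\<forall>j. strongly_convergent (W j) (\<lambda>k. proj j (v k))"
      and bounded: "bounded (range (\<lambda>k. vnorm L (v k)))"
      and uniform: "uniform_limit UNIV (\<lambda>j k. vnorm (W j) (proj j (v k)))
        (\<lambda>k. vnorm L (v k)) sequentially"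
    then have v: "v k \<in> carrier L" "v k \<in> V" for k using V by auto
    obtain M where M: "\<And>k. vnorm L (v k) \<le> M"
      using bounded unfolding bounded_iff by (auto simp: abs_le_iff)
    obtain w where w: "w \<in> carrier L"
      "\<And>j. (\<lambda>k. vnorm (W j) (vminus (W j) (v k j) (w j))) \<longlonglongrightarrow> 0"
      using stagewise_limit[of v M, OF v(1) M] conv unfolding proj_def by blast
    \<comment> \<open>Uniformity permits exchanging the limits over stages and over the sequence.\<close>
    have "(\<lambda>k. vnorm L (v k)) \<longlonglongrightarrow> vnorm L w"
    proof (rule swap_uniform_limit'[OF _ limit_norm_tendsto[OF w(1)] uniform])
      show "\<forall>\<^sub>F j in sequentially. (\<lambda>k. vnorm (W j) (proj j (v k))) \<longlonglongrightarrow> vnorm (W j) (w j)"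
        unfolding proj_def
        by (intro always_eventually allI W.norm_tendsto limit_stage v w)
    qed auto
    then have "strongly_convergent (dual_space Y) (\<lambda>k. C (v k))"
      using anp[unfolded asymptotic_norming_property_def, rule_format, of "\<lambda>k. C (v k)" "C w"]
        weak_star_limitI[OF v(1) w(1) M w(2)] v w(1) by (simp add: dual_iso_norm image_subset_iff)
    then show "strongly_convergent L v"
      by (simp add: strongly_convergent_dual_iso[OF v(1)])
  qed
next
  interpret W: normed_space "W i" for i by (rule stage)
  assume dp: "determining_property W \<theta> V"
  show "asymptotic_norming_property Y (C ` V)"
    unfolding asymptotic_norming_property_def
  proof (intro allI impI, elim conjE)
    fix u f assume u: "range u \<subseteq> C ` V" and weak: "weak_star_limit Y u f"
      and norms: "(\<lambda>k. vnorm (dual_space Y) (u k)) \<longlonglongrightarrow> vnorm (dual_space Y) f"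
    have "\<forall>k. \<exists>x. x \<in> V \<and> u k = C x" using u by blast
    then obtain v where vV: "\<And>k. v k \<in> V" and uv: "u = (\<lambda>k. C (v k))" by metis
    have v: "v k \<in> carrier L" for k using vV V by blast
    obtain w where w: "w \<in> carrier L" "C w = f"
      using weak dual_iso_surj unfolding weak_star_limit_def by blast
    have conv: "(\<lambda>k. vnorm (W j) (vminus (W j) (v k j) (w j))) \<longlonglongrightarrow> 0" for j
      using weak_star_limitD[OF v w(1)] weak uv w(2) by simp
    have lim: "(\<lambda>k. vnorm L (v k)) \<longlonglongrightarrow> vnorm L w"
      using norms by (simp add: uv w(2)[symmetric] dual_iso_norm v w(1))
    have "strongly_convergent L v"
    proof (rule dp[unfolded determining_property_def, rule_format], intro conjI allI)
      show "range v \<subseteq> V" using vV by blast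
      show "strongly_convergent (W j) (\<lambda>k. proj j (v k))" for j
        using W.strongly_convergent_iff[of "\<lambda>k. v k j"] limit_stage[OF v] limit_stage[OF w(1)] conv[of j]
        unfolding proj_def by blast
      show "bounded (range (\<lambda>k. vnorm L (v k)))"
        using lim by (intro convergent_imp_bounded)
      show "uniform_limit UNIV (\<lambda>j k. vnorm (W j) (proj j (v k))) (\<lambda>k. vnorm L (v k)) sequentially"
        unfolding proj_def
        by (rule uniform_limit_of_monotone[OF limit_incseq[OF v] limit_norm_tendsto[OF v] _
          limit_norm_tendsto[OF w(1)] lim])
          (rule W.norm_tendsto[OF limit_stage[OF v] limit_stage[OF w(1)] conv])
    qed
    then show "strongly_convergent (dual_space Y) u"
      by (simp add: uv strongly_convergent_dual_iso[OF v])
  qed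
qed

end

theorem proposition3p3:
  fixes W :: "nat \<Rightarrow> 'a vstruct"
    and \<theta> :: "nat \<Rightarrow> 'a \<Rightarrow> 'a"
    and V :: "(nat \<Rightarrow> 'a) set"
  assumes "standard_inverse_system W \<theta>"
    and "vsubspace (inverse_limit W \<theta>) V"
    and "closedin (norm_topology (inverse_limit W \<theta>)) V"
    and "separable_space (subtopology (norm_topology (inverse_limit W \<theta>)) V)"
  shows "asymptotic_norming_property (predual W \<theta>) (dual_iso W \<theta> ` V)
    \<longleftrightarrow> determining_property W \<theta> V"
  using inverse_system.asymptotic_norming_iff_determining[of W \<theta> V] assms(1,2)
  unfolding inverse_system_def vsubspace_def by blast

end
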